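(* Let $\theta_q:H_n(q)\to\mathbb Z[q^{1/2},q^{-1/2}]$ be any $\mathbb Z[q^{1/2},q^{-1/2}]$-linear function, let $s_{i_1}\cdots s_{i_m}$ be any expression in the generators of $\mathfrak S_n$, and let $B$ be the weighted path matrix of its wiring diagram. Then $$\theta_q\big((1+T_{s_{i_1}})\cdots(1+T_{s_{i_m}})\big)=\sigma_B\big(\mathrm{Imm}_{\theta_q}(x)\big),\qquad\text{where }\ \mathrm{Imm}_{\theta_q}(x)=\sum_{w\in\mathfrak S_n}\theta_q(T_w)\,q^{-\ell(w)/2}\,x_{1,w_1}x_{2,w_2}\cdots x_{n,w_n}.$$
   Context: The Hecke algebra $H_n(q)$ is the unital algebra over $\mathbb Z[q^{1/2},q^{-1/2}]$ generated by $T_{s_1},\dots,T_{s_{n-1}}$ with $T_{s_i}^2=(q-1)T_{s_i}+qT_e$, $T_{s_i}T_{s_j}T_{s_i}=T_{s_j}T_{s_i}T_{s_j}$ for $|i-j|=1$, $T_{s_i}T_{s_j}=T_{s_j}T_{s_i}$ for $|i-j|\ge2$; $T_w=T_{s_{i_1}}\cdots T_{s_{i_\ell}}$ for a reduced expression of $w$; $1=T_e$; $\ell(w)$ the length. One-line notation $w_1\cdots w_n$ of $w$ is obtained by letting an expression of $w$ act on the word $1\cdots n$, $s_j$ swapping letters in positions $j,j+1$. Quantum matrix bialgebra $\mathcal A$: generated over $\mathbb Z[q^{1/2},q^{-1/2}]$ by $x_{i,j}$ with relations, for $i<j$, $k<\ell$: $x_{i,\ell}x_{i,k}=q^{1/2}x_{i,k}x_{i,\ell}$,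 $x_{j,k}x_{i,\ell}=x_{i,\ell}x_{j,k}$, $x_{j,k}x_{i,k}=q^{1/2}x_{i,k}x_{j,k}$, $x_{j,\ell}x_{i,k}=x_{i,k}x_{j,\ell}+(q^{1/2}-q^{-1/2})x_{i,\ell}x_{j,k}$; $x^{u,v}=x_{u_1,v_1}\cdots x_{u_n,v_n}$; $\mathcal A_{[n],[n]}$ is the span of the $x^{u,v}$, with basis $\{x^{e,v}\}$. Wiring diagram $G$ of $s_{i_1}\cdots s_{i_m}$: left-to-right concatenation of elementary diagrams $G_1..G_m$ with levels $1..n$ (bottom to top); in $G_j$ levels $h\notin\{i_j,i_j+1\}$ are horizontal edges of weight 1 and levels $i_j,i_j+1$ pass through a central vertex via edges weighted $z_{i_j,j,1}$ (in from level $i_j$), $z_{i_j,j,2}$ (out to level $i_j$), $z_{i_j+1,j,1}$ (in from level $i_j+1$), $z_{i_j+1,j,2}$ (out to level $i_j+1$); sources $1..n$ left, sinks $1..n$ right, edges oriented left to right. $Z_G$: algebra over $\mathbb Z[q^{\pm1/2}]$ (central) generated by the variables, $z_{h,j,k},z_{h',j',k'}$ commuting if $j\ne j'$ or $k\ne k'$, and $z_{i_j+1,j,k}z_{i_j,j,k}=q^{1/2}z_{i_j,j,k}z_{i_j+1,j,k}$; $z_G$ the product of all $4m$ variables in lexicographic order; $[z_G]f$ the coefficient of $z_G$ in the lexicographically ordered monomial basis. Path weight = product of edge weights in traversal order; $B=(b_{i,j})$ with $b_{i,j}$ the sum of weights of paths source $i\to$ sink $j$; $\sigma_B$ the linear map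 $\mathcal A_{[n],[n]}\to\mathbb Z[q^{\pm1/2}]$ with $\sigma_B(x^{e,v})=[z_G]b_{1,v_1}\cdots b_{n,v_n}$. *)

theory Defs
  imports
    "HOL-Algebra.QuotRing"
    "HOL-Algebra.Module"
    "HOL-Library.Poly_Mapping"
    "HOL-Combinatorics.Permutations"
    "Graph_Theory.Arc_Walk"
begin

section \<open>Laurent polynomials in the square root of q\<close>

text \<open>The ring of integral Laurent polynomials in \<open>q^(1/2)\<close> is the group ring of the
  integers, with convolution product; the exponent \<open>k\<close> stands for \<open>q^(k/2)\<close>.\<close>

type_synonym laurent = "int \<Rightarrow>\<^sub>0 int"

definition qhalf :: "int \<Rightarrow> laurent" where
  "qhalf k = Poly_Mapping.single k 1"

abbreviation q_var :: laurent where
  "q_var \<equiv> qhalf 2"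


section \<open>Algebras given by generators and relations\<close>

datatype 'g fword = FWord (letters: "'g list")

instantiation fword :: (type) monoid_add
begin

definition zero_fword :: "'a fword" where
  "zero_fword = FWord []"

definition plus_fword :: "'a fword \<Rightarrow> 'a fword \<Rightarrow> 'a fword" where
  "plus_fword u v = FWord (letters u @ letters v)"

instance
  by standard (auto simp: zero_fword_def plus_fword_def)

end

text \<open>The free associative unital algebra is the monoid algebra of the free monoid.\<close>

type_synonym 'g freealg = "'g fword \<Rightarrow>\<^sub>0 laurent"

definition fvar :: "'g \<Rightarrow> 'g freealg" where
  "fvar g = Poly_Mapping.single (FWord [g]) 1"

definition fscalar :: "laurent \<Rightarrow> 'g freealg" where
  "fscalar c = Poly_Mapping.single 0 c"

definition free_algebra :: "'g set \<Rightarrow> 'g freealg ring" where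
  "free_algebra X =
     \<lparr>carrier = {p. \<forall>w \<in> Poly_Mapping.keys p. set (letters w) \<subseteq> X},
      monoid.mult = (*), one = 1, zero = 0, add = (+)\<rparr>"

text \<open>Relations are given as elements of the free algebra that are to become zero.
  Elements of the presented algebra are cosets of the generated two-sided ideal.\<close>

definition presented_algebra ::
  "'g set \<Rightarrow> 'g freealg set \<Rightarrow> (laurent, 'g freealg set) module" where
  "presented_algebra X Rel =
     (let F = free_algebra X; I = Idl\<^bsub>F\<^esub> Rel; Q = F Quot I
      in \<lparr>carrier = carrier Q, monoid.mult = monoid.mult Q, one = one Q, zero = zero Q, add = add Q,
          smult = (\<lambda>c a. (I +>\<^bsub>F\<^esub> fscalar c) \<otimes>\<^bsub>Q\<^esub> a)\<rparr>)"

lemma free_algebra_ring: "ring (free_algebra X)"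
proof -
  let ?F = "free_algebra X"
  have carr: "p \<in> carrier ?F \<longleftrightarrow> (\<forall>w \<in> Poly_Mapping.keys p. set (letters w) \<subseteq> X)" for p
    by (simp add: free_algebra_def)
  have ops: "monoid.mult ?F = (*)" "one ?F = 1" "zero ?F = 0" "add ?F = (+)"
    by (simp_all add: free_algebra_def)
  have plus: "p + p' \<in> carrier ?F" if "p \<in> carrier ?F" "p' \<in> carrier ?F" for p p'
    using that Poly_Mapping.keys_add[of p p'] unfolding carr by blast
  have times: "p * p' \<in> carrier ?F" if "p \<in> carrier ?F" "p' \<in> carrier ?F" for p p'
  proof -
    have "set (letters (a + b)) \<subseteq> X"
      if "a \<in> Poly_Mapping.keys p" "b \<in> Poly_Mapping.keys p'" for a b
      using that \<open>p \<in> carrier ?F\<close> \<open>p' \<in> carrier ?F\<close> by (simp add: plus_fword_def carr)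
    then show ?thesis
      using keys_mult[of p p'] unfolding carr by blast
  qed
  have unit_zero: "0 \<in> carrier ?F" "1 \<in> carrier ?F"
    by (simp_all add: carr zero_fword_def)
  have uminus: "- p \<in> carrier ?F" if "p \<in> carrier ?F" for p
    using that by (simp add: carr)
  show ?thesis
  proof (rule ringI)
    show "abelian_group ?F"
    proof (rule abelian_groupI)
      fix x assume "x \<in> carrier ?F"
      then show "\<exists>y\<in>carrier ?F. y \<oplus>\<^bsub>?F\<^esub> x = \<zero>\<^bsub>?F\<^esub>"
        by (intro bexI[of _ "- x"]) (simp_all add: ops uminus)
    qed (simp_all add: ops plus unit_zero add_ac)
    show "monoid ?F"
      by (rule monoidI) (simp_all add: ops times unit_zero mult.assoc)
  qed (simp_all add: ops distrib_left distrib_right)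
qed

definition presented_gen :: "'g set \<Rightarrow> 'g freealg set \<Rightarrow> 'g \<Rightarrow> 'g freealg set" where
  "presented_gen X Rel g = (Idl\<^bsub>free_algebra X\<^esub> Rel) +>\<^bsub>free_algebra X\<^esub> fvar g"

definition list_prod :: "('a, 'b) monoid_scheme \<Rightarrow> 'a list \<Rightarrow> 'a" where
  "list_prod A xs = foldr (monoid.mult A) xs \<one>\<^bsub>A\<^esub>"

definition linear_on ::
  "(laurent, 'a, 'b) module_scheme \<Rightarrow> 'a set \<Rightarrow> ('a \<Rightarrow> laurent) \<Rightarrow> bool" where
  "linear_on A M f \<longleftrightarrow>
     (\<forall>a\<in>M. \<forall>b\<in>M. f (a \<oplus>\<^bsub>A\<^esub> b) = f a + f b) \<and>
     (\<forall>c. \<forall>a\<in>M. f (c \<odot>\<^bsub>A\<^esub> a) = c * f a)"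

definition linear_span :: "(laurent, 'a, 'b) module_scheme \<Rightarrow> 'a set \<Rightarrow> 'a set" where
  "linear_span A S = {\<Oplus>\<^bsub>A\<^esub>b\<in>F. c b \<odot>\<^bsub>A\<^esub> b | F c. finite F \<and> F \<subseteq> S}"

text \<open>The coefficients of \<open>f\<close> with respect to a basis \<open>(e i)\<close> indexed by \<open>i \<in> I\<close>.\<close>

definition basis_coeffs ::
  "(laurent, 'a, 'b) module_scheme \<Rightarrow> 'i set \<Rightarrow> ('i \<Rightarrow> 'a) \<Rightarrow> 'a \<Rightarrow> ('i \<Rightarrow>\<^sub>0 laurent)" where
  "basis_coeffs A I e f =
     (THE c. Poly_Mapping.keys c \<subseteq> I \<and>
        f = (\<Oplus>\<^bsub>A\<^esub>i\<in>Poly_Mapping.keys c. Poly_Mapping.lookup c i \<odot>\<^bsub>A\<^esub> e i))"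


section \<open>The symmetric group\<close>

text \<open>An element of the symmetric group is represented by its one-line notation, i.e. by the
  function \<open>w\<close> permuting \<open>{1..n}\<close> whose value \<open>w k\<close> is the letter in position \<open>k\<close>. An expression
  acts on the word \<open>1 2 \<dots> n\<close> from the left, so its last factor acts first, and precomposition
  with \<open>transpose j (Suc j)\<close> swaps the letters in positions \<open>j\<close> and \<open>j + 1\<close>. Thus the
  product of the group is composition of functions in the reverse order.\<close>

definition expr_perm :: "nat list \<Rightarrow> nat \<Rightarrow> nat" where
  "expr_perm ss = foldr (\<lambda>j w. w \<circ> Transposition.transpose j (Suc j)) ss id"

definition is_expression :: "nat \<Rightarrow> nat list \<Rightarrow> bool" where
  "is_expression n ss \<longleftrightarrow> set ss \<subseteq> {1..<n}"

definition perm_length :: "nat \<Rightarrow> (nat \<Rightarrow> nat) \<Rightarrow> nat" where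
  "perm_length n w =
     (LEAST k. \<exists>ss. is_expression n ss \<and> expr_perm ss = w \<and> length ss = k)"

definition reduced_expression :: "nat \<Rightarrow> (nat \<Rightarrow> nat) \<Rightarrow> nat list \<Rightarrow> bool" where
  "reduced_expression n w ss \<longleftrightarrow>
     is_expression n ss \<and> expr_perm ss = w \<and> length ss = perm_length n w"


section \<open>The Hecke algebra\<close>

definition hecke_rels :: "nat \<Rightarrow> nat freealg set" where
  "hecke_rels n =
     {fvar i * fvar i - (fscalar (q_var - 1) * fvar i + fscalar q_var) | i. i \<in> {1..<n}} \<union>
     {fvar i * fvar j * fvar i - fvar j * fvar i * fvar j | i j.
        i \<in> {1..<n} \<and> j \<in> {1..<n} \<and> \<bar>int i - int j\<bar> = 1} \<union>
     {fvar i * fvar j - fvar j * fvar i | i j.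
        i \<in> {1..<n} \<and> j \<in> {1..<n} \<and> \<bar>int i - int j\<bar> \<ge> 2}"

definition hecke :: "nat \<Rightarrow> (laurent, nat freealg set) module" where
  "hecke n = presented_algebra {1..<n} (hecke_rels n)"

definition hecke_gen :: "nat \<Rightarrow> nat \<Rightarrow> nat freealg set" where
  "hecke_gen n i = presented_gen {1..<n} (hecke_rels n) i"

text \<open>By Matsumoto's theorem the choice of the reduced expression does not matter.\<close>

definition hecke_T :: "nat \<Rightarrow> (nat \<Rightarrow> nat) \<Rightarrow> nat freealg set" where
  "hecke_T n w =
     list_prod (hecke n) (map (hecke_gen n) (SOME ss. reduced_expression n w ss))"


section \<open>The quantum matrix bialgebra\<close>

abbreviation xvar :: "nat \<Rightarrow> nat \<Rightarrow> (nat \<times> nat) freealg" where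
  "xvar i j \<equiv> fvar (i, j)"

definition qmat_rels :: "nat \<Rightarrow> (nat \<times> nat) freealg set" where
  "qmat_rels n =
     {xvar i l * xvar i k - fscalar (qhalf 1) * xvar i k * xvar i l | i k l.
        i \<in> {1..n} \<and> k \<in> {1..n} \<and> l \<in> {1..n} \<and> k < l} \<union>
     {xvar j k * xvar i l - xvar i l * xvar j k | i j k l.
        i \<in> {1..n} \<and> j \<in> {1..n} \<and> k \<in> {1..n} \<and> l \<in> {1..n} \<and> i < j \<and> k < l} \<union>
     {xvar j k * xvar i k - fscalar (qhalf 1) * xvar i k * xvar j k | i j k.
        i \<in> {1..n} \<and> j \<in> {1..n} \<and> k \<in> {1..n} \<and> i < j} \<union>
     {xvar j l * xvar i k
        - (xvar i k * xvar j l + fscalar (qhalf 1 - qhalf (-1)) * xvar i l * xvar j k) | i j k l.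
        i \<in> {1..n} \<and> j \<in> {1..n} \<and> k \<in> {1..n} \<and> l \<in> {1..n} \<and> i < j \<and> k < l}"

definition qmat :: "nat \<Rightarrow> (laurent, (nat \<times> nat) freealg set) module" where
  "qmat n = presented_algebra ({1..n} \<times> {1..n}) (qmat_rels n)"

definition qmat_x :: "nat \<Rightarrow> nat \<Rightarrow> nat \<Rightarrow> (nat \<times> nat) freealg set" where
  "qmat_x n i j = presented_gen ({1..n} \<times> {1..n}) (qmat_rels n) (i, j)"

definition qmat_monom :: "nat \<Rightarrow> (nat \<Rightarrow> nat) \<Rightarrow> (nat \<Rightarrow> nat) \<Rightarrow> (nat \<times> nat) freealg set" where
  "qmat_monom n u v = list_prod (qmat n) (map (\<lambda>k. qmat_x n (u k) (v k)) [1..<Suc n])"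

definition immanant_space :: "nat \<Rightarrow> (nat \<times> nat) freealg set set" where
  "immanant_space n =
     linear_span (qmat n) {qmat_monom n u v | u v. u permutes {1..n} \<and> v permutes {1..n}}"

definition Imm :: "nat \<Rightarrow> (nat freealg set \<Rightarrow> laurent) \<Rightarrow> (nat \<times> nat) freealg set" where
  "Imm n \<theta> =
     (\<Oplus>\<^bsub>qmat n\<^esub>w\<in>{w. w permutes {1..n}}.
        (\<theta> (hecke_T n w) * qhalf (- int (perm_length n w))) \<odot>\<^bsub>qmat n\<^esub> qmat_monom n id w)"


section \<open>Wiring diagrams\<close>

text \<open>\<open>Junction h j\<close> is the point at level \<open>h\<close> where the j-th elementary diagram ends and
  the next one begins; \<open>Center j\<close> is the central vertex of the j-th elementary diagram.\<close>

datatype wire_vertex = Junction nat nat | Center nat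

datatype wire_arc = Straight nat nat | Enter nat nat | Leave nat nat

text \<open>Factors of an expression are numbered from 1.\<close>

definition crossing :: "nat list \<Rightarrow> nat \<Rightarrow> nat" where
  "crossing ss j = ss ! (j - 1)"

definition crossing_levels :: "nat list \<Rightarrow> nat \<Rightarrow> nat set" where
  "crossing_levels ss j = {crossing ss j, Suc (crossing ss j)}"

fun wire_tail :: "wire_arc \<Rightarrow> wire_vertex" where
  "wire_tail (Straight h j) = Junction h (j - 1)"
| "wire_tail (Enter h j) = Junction h (j - 1)"
| "wire_tail (Leave h j) = Center j"

fun wire_head :: "wire_arc \<Rightarrow> wire_vertex" where
  "wire_head (Straight h j) = Junction h j"
| "wire_head (Enter h j) = Center j"
| "wire_head (Leave h j) = Junction h j"

definition wiring_diagram :: "nat \<Rightarrow> nat list \<Rightarrow> (wire_vertex, wire_arc) pre_digraph" where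
  "wiring_diagram n ss =
     \<lparr>verts = {Junction h j | h j. h \<in> {1..n} \<and> j \<le> length ss} \<union> Center ` {1..length ss},
      arcs = {Straight h j | h j.
                j \<in> {1..length ss} \<and> h \<in> {1..n} - crossing_levels ss j} \<union>
             {Enter h j | h j. j \<in> {1..length ss} \<and> h \<in> crossing_levels ss j} \<union>
             {Leave h j | h j. j \<in> {1..length ss} \<and> h \<in> crossing_levels ss j},
      tail = wire_tail, head = wire_head\<rparr>"


section \<open>The algebra of edge weights\<close>

text \<open>The index triples \<open>(h, j, k)\<close> of the variables, in lexicographic order.\<close>

definition wire_vars :: "nat \<Rightarrow> nat list \<Rightarrow> (nat \<times> nat \<times> nat) list" where
  "wire_vars n ss =
     [(h, j, k). h \<leftarrow> [1..<Suc n], j \<leftarrow> [1..<Suc (length ss)], h \<in> crossing_levels ss j,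
        k \<leftarrow> [1, 2]]"

definition wire_rels :: "nat \<Rightarrow> nat list \<Rightarrow> (nat \<times> nat \<times> nat) freealg set" where
  "wire_rels n ss =
     {fvar (h, j, k) * fvar (h', j', k') - fvar (h', j', k') * fvar (h, j, k) | h j k h' j' k'.
        (h, j, k) \<in> set (wire_vars n ss) \<and> (h', j', k') \<in> set (wire_vars n ss) \<and>
        (j \<noteq> j' \<or> k \<noteq> k')} \<union>
     {fvar (Suc (crossing ss j), j, k) * fvar (crossing ss j, j, k)
        - fscalar (qhalf 1) * fvar (crossing ss j, j, k) * fvar (Suc (crossing ss j), j, k) | j k.
        j \<in> {1..length ss} \<and> k \<in> {1, 2}}"

definition wire_algebra ::
  "nat \<Rightarrow> nat list \<Rightarrow> (laurent, (nat \<times> nat \<times> nat) freealg set) module" where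
  "wire_algebra n ss = presented_algebra (set (wire_vars n ss)) (wire_rels n ss)"

definition wire_z ::
  "nat \<Rightarrow> nat list \<Rightarrow> nat \<times> nat \<times> nat \<Rightarrow> (nat \<times> nat \<times> nat) freealg set" where
  "wire_z n ss = presented_gen (set (wire_vars n ss)) (wire_rels n ss)"

definition wire_monom ::
  "nat \<Rightarrow> nat list \<Rightarrow> (nat \<times> nat \<times> nat \<Rightarrow> nat) \<Rightarrow> (nat \<times> nat \<times> nat) freealg set" where
  "wire_monom n ss a =
     list_prod (wire_algebra n ss)
       (map (\<lambda>v. wire_z n ss v [^]\<^bsub>wire_algebra n ss\<^esub> a v) (wire_vars n ss))"

definition wire_exponents :: "nat \<Rightarrow> nat list \<Rightarrow> (nat \<times> nat \<times> nat \<Rightarrow> nat) set" where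
  "wire_exponents n ss = {a. \<forall>v. v \<notin> set (wire_vars n ss) \<longrightarrow> a v = 0}"

text \<open>The coefficient of the product of all variables: every exponent equals 1.\<close>

definition zG_coeff :: "nat \<Rightarrow> nat list \<Rightarrow> (nat \<times> nat \<times> nat) freealg set \<Rightarrow> laurent" where
  "zG_coeff n ss f =
     Poly_Mapping.lookup
       (basis_coeffs (wire_algebra n ss) (wire_exponents n ss) (wire_monom n ss) f)
       (\<lambda>v. if v \<in> set (wire_vars n ss) then 1 else 0)"

fun arc_weight :: "nat \<Rightarrow> nat list \<Rightarrow> wire_arc \<Rightarrow> (nat \<times> nat \<times> nat) freealg set" where
  "arc_weight n ss (Straight h j) = \<one>\<^bsub>wire_algebra n ss\<^esub>"
| "arc_weight n ss (Enter h j) = wire_z n ss (h, j, 1)"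
| "arc_weight n ss (Leave h j) = wire_z n ss (h, j, 2)"

definition path_matrix ::
  "nat \<Rightarrow> nat list \<Rightarrow> nat \<Rightarrow> nat \<Rightarrow> (nat \<times> nat \<times> nat) freealg set" where
  "path_matrix n ss i j =
     (\<Oplus>\<^bsub>wire_algebra n ss\<^esub>p\<in>{p. pre_digraph.apath (wiring_diagram n ss)
                                  (Junction i 0) p (Junction j (length ss))}.
        list_prod (wire_algebra n ss) (map (arc_weight n ss) p))"

text \<open>The two conditions determine the map on the immanant space, because the monomials
  \<open>x^(e,v)\<close> form a basis of it.\<close>

definition sigma :: "nat \<Rightarrow> nat list \<Rightarrow> (nat \<times> nat) freealg set \<Rightarrow> laurent" where
  "sigma n ss =
     (SOME \<sigma>. linear_on (qmat n) (immanant_space n) \<sigma> \<and>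
        (\<forall>v. v permutes {1..n} \<longrightarrow>
           \<sigma> (qmat_monom n id v) =
             zG_coeff n ss
               (list_prod (wire_algebra n ss)
                  (map (\<lambda>i. path_matrix n ss i (v i)) [1..<Suc n]))))"

end

theory Submission
  imports Defs
begin

text \<open>
  Sending \<open>x\<^sub>i\<^sub>,\<^sub>j\<close> to the path weight \<open>b\<^sub>i\<^sub>,\<^sub>j\<close> respects the relations of the quantum
  matrix bialgebra. A crossing combines two adjacent columns of the path matrix into one column with
  q-commuting coefficients and then multiplies that column by two q-commuting variables, and
  both steps preserve the relations. Taking the coefficient of \<open>z\<^sub>G\<close> afterwards gives \<open>\<sigma>\<^sub>B\<close>
  on the whole bialgebra, so it exists without appeal to a basis of the immanant space.

  Let \<open>F(w)\<close> be the coefficient of \<open>z\<^sub>G\<close> in \<open>b\<^sub>1\<^sub>,\<^sub>w\<^sub>1 \<cdots> b\<^sub>n\<^sub>,\<^sub>w\<^sub>n\<close>. In a term that uses every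
  variable once, the two paths meeting at a crossing either continue on their levels or exchange
  them, and each of the two pairs of variables contributes \<open>q^(1/2)\<close> exactly when the path with
  the smaller source uses the upper level. Appending a crossing \<open>s\<close> therefore changes \<open>F\<close> in
  the same way as right multiplication by \<open>1 + T\<^sub>s\<close> changes the coordinates of an element with
  respect to \<open>q^(-l(w)/2) T\<^sub>w\<close>. Hence the product of the \<open>1 + T\<^sub>s\<close> is the sum of all
  \<open>q^(-l(w)/2) F(w) T\<^sub>w\<close>, and the theorem follows by applying \<open>\<theta>\<close>.
\<close>

section \<open>Homomorphisms out of a monoid algebra\<close>

text \<open>Both \<open>zG_coeff\<close> and \<open>sigma\<close> are given by description
  operators, so nothing can be said about them until an expansion in ordered monomials is shown to
  exist uniquely and a functional with the prescribed values is shown to exist. Reordering gives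
  existence of the expansion. For uniqueness the edge algebra is mapped to a concrete model, a
  monoid algebra whose monomials carry their power of \<open>q^(1/2)\<close>, where distinct
  monomials are independent by construction. The quantum matrix bialgebra is mapped to the same
  model.

  The factor \<open>q^(-l(w)/2)\<close> repairs an asymmetry: between \<open>w\<close> and its
  neighbour \<open>w s\<close>, multiplication by \<open>1 + T_s\<close> passes a coordinate upward
  with factor \<open>1\<close> and downward with factor \<open>q\<close>, while exchanging two paths
  costs \<open>q^(1/2)\<close> in either direction. The lengths differ by one, so rescaling turns
  the first pair of factors into the second.

  \<open>Imm\<close> is a combination of the monomials \<open>x^(e,w)\<close>, where
  \<open>sigma\<close> has prescribed values, so any functional that the choice operator may pick
  gives the same result.\<close>

definition alg_eval :: "('b::ring_1 \<Rightarrow> 'k::ring_1) \<Rightarrow> ('a::monoid_add \<Rightarrow> 'k) \<Rightarrow> ('a \<Rightarrow>\<^sub>0 'b) \<Rightarrow> 'k" where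
  "alg_eval \<phi> g p = (\<Sum>w\<in>Poly_Mapping.keys p. \<phi> (Poly_Mapping.lookup p w) * g w)"

lemma poly_mapping_sum_singles:
  "(\<Sum>k\<in>Poly_Mapping.keys p. Poly_Mapping.single k (Poly_Mapping.lookup p k)) = p"
proof (rule poly_mapping_eqI)
  fix x
  show "Poly_Mapping.lookup (\<Sum>k\<in>Poly_Mapping.keys p. Poly_Mapping.single k (Poly_Mapping.lookup p k)) x
    = Poly_Mapping.lookup p x"
    by (simp add: lookup_sum lookup_single when_def sum.delta' in_keys_iff)
qed

lemma poly_mapping_add_induct [case_names zero single add]:
  assumes "P 0" "\<And>k c. P (Poly_Mapping.single k c)" "\<And>p q. P p \<Longrightarrow> P q \<Longrightarrow> P (p + q)"
  shows "P (p :: 'a \<Rightarrow>\<^sub>0 'b::comm_monoid_add)"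
proof -
  have "P (\<Sum>k\<in>S. Poly_Mapping.single k (Poly_Mapping.lookup p k))" if "finite S" for S
    using that by induction (auto intro: assms)
  from this[of "Poly_Mapping.keys p"] show ?thesis
    by (simp add: poly_mapping_sum_singles)
qed

text \<open>Serves twice: for the Laurent ring as the group ring of the integers, and for the free
  algebra as the monoid algebra of words. The target is noncommutative, so multiplicativity of the
  linear extension rests on scalars commuting with the images of the basis.\<close>

locale monoid_algebra_hom =
  fixes \<phi> :: "'b::ring_1 \<Rightarrow> 'k::ring_1" and g :: "'a::monoid_add \<Rightarrow> 'k"
  assumes scalar_add: "\<phi> (a + b) = \<phi> a + \<phi> b"
    and scalar_mult: "\<phi> (a * b) = \<phi> a * \<phi> b"
    and scalar_one: "\<phi> 1 = 1"
    and basis_zero: "g 0 = 1"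
    and basis_add: "g (u + v) = g u * g v"
    and scalar_comm: "\<phi> a * g v = g v * \<phi> a"
begin

lemma scalar_zero: "\<phi> 0 = 0"
  using scalar_add[of 0 0] by simp

lemma eval_superset:
  assumes "finite S" "Poly_Mapping.keys p \<subseteq> S"
  shows "alg_eval \<phi> g p = (\<Sum>w\<in>S. \<phi> (Poly_Mapping.lookup p w) * g w)"
  unfolding alg_eval_def
  by (rule sum.mono_neutral_left) (use assms in \<open>auto simp: in_keys_iff scalar_zero\<close>)

lemma eval_zero: "alg_eval \<phi> g 0 = 0"
  by (simp add: alg_eval_def)

lemma eval_add: "alg_eval \<phi> g (p + q) = alg_eval \<phi> g p + alg_eval \<phi> g q"
proof -
  let ?S = "Poly_Mapping.keys p \<union> Poly_Mapping.keys q"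
  have "alg_eval \<phi> g (p + q) = (\<Sum>w\<in>?S. \<phi> (Poly_Mapping.lookup (p + q) w) * g w)"
    by (rule eval_superset) (auto dest: subsetD[OF Poly_Mapping.keys_add])
  also have "\<dots> = (\<Sum>w\<in>?S. \<phi> (Poly_Mapping.lookup p w) * g w) + (\<Sum>w\<in>?S. \<phi> (Poly_Mapping.lookup q w) * g w)"
    by (simp add: lookup_add scalar_add distrib_right sum.distrib)
  also have "\<dots> = alg_eval \<phi> g p + alg_eval \<phi> g q"
    by (subst (1 2) eval_superset[symmetric]) auto
  finally show ?thesis .
qed

lemma eval_uminus: "alg_eval \<phi> g (- p) = - alg_eval \<phi> g p"
  using eval_add[of p "- p"] by (simp add: eval_zero eq_neg_iff_add_eq_0 add.commute)

lemma eval_diff: "alg_eval \<phi> g (p - q) = alg_eval \<phi> g p - alg_eval \<phi> g q"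
  using eval_add[of p "- q"] by (simp add: eval_uminus)

lemma eval_single: "alg_eval \<phi> g (Poly_Mapping.single w c) = \<phi> c * g w"
  using scalar_zero by (cases "c = 0") (simp_all add: alg_eval_def)

lemma eval_one: "alg_eval \<phi> g 1 = 1"
  using eval_single[of 0 1] by (simp add: basis_zero scalar_one)

lemma eval_mult: "alg_eval \<phi> g (p * q) = alg_eval \<phi> g p * alg_eval \<phi> g q"
proof (induction p rule: poly_mapping_add_induct)
  case (single u c)
  show ?case
  proof (induction q rule: poly_mapping_add_induct)
    case (single v d)
    have "\<phi> c * \<phi> d * (g u * g v) = \<phi> c * g u * (\<phi> d * g v)"
      by (metis scalar_comm mult.assoc)
    then show ?case
      by (simp add: mult_single eval_single scalar_mult basis_add)
  qed (simp_all add: eval_zero eval_add distrib_left)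
qed (simp_all add: eval_zero eval_add distrib_right)

lemma eval_sum: "alg_eval \<phi> g (sum f S) = (\<Sum>x\<in>S. alg_eval \<phi> g (f x))"
  by (induction S rule: infinite_finite_induct) (simp_all add: eval_zero eval_add)

lemma eval_prod_list: "alg_eval \<phi> g (prod_list xs) = prod_list (map (alg_eval \<phi> g) xs)"
  by (induction xs) (simp_all add: eval_one eval_mult)

end


section \<open>Presented algebras\<close>

lemma carrier_free_algebra:
  "p \<in> carrier (free_algebra X) \<longleftrightarrow> (\<forall>w \<in> Poly_Mapping.keys p. set (letters w) \<subseteq> X)"
  by (simp add: free_algebra_def)

lemma free_algebra_ops [simp]:
  "monoid.mult (free_algebra X) = (*)" "one (free_algebra X) = 1"
  "zero (free_algebra X) = 0" "add (free_algebra X) = (+)"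
  by (simp_all add: free_algebra_def)

lemma free_algebra_uminus_closed: "p \<in> carrier (free_algebra X) \<Longrightarrow> - p \<in> carrier (free_algebra X)"
  by (simp add: carrier_free_algebra)

lemma free_algebra_a_inv:
  assumes "p \<in> carrier (free_algebra X)"
  shows "\<ominus>\<^bsub>free_algebra X\<^esub> p = - p"
proof -
  interpret F: ring "free_algebra X" by (rule free_algebra_ring)
  show ?thesis
    using F.minus_equality[of "- p" p] assms free_algebra_uminus_closed[OF assms] by simp
qed

lemma free_algebra_closed:
  assumes "p \<in> carrier (free_algebra X)" "q \<in> carrier (free_algebra X)"
  shows "p + q \<in> carrier (free_algebra X)" "p * q \<in> carrier (free_algebra X)"
    "p - q \<in> carrier (free_algebra X)"
proof -
  interpret F: ring "free_algebra X" by (rule free_algebra_ring)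
  show "p + q \<in> carrier (free_algebra X)" "p * q \<in> carrier (free_algebra X)"
    using F.a_closed[OF assms] F.m_closed[OF assms] by simp_all
  show "p - q \<in> carrier (free_algebra X)"
    using F.a_closed[OF assms(1) free_algebra_uminus_closed[OF assms(2)]] by simp
qed

lemma free_algebra_zero_closed: "0 \<in> carrier (free_algebra X)"
  and free_algebra_one_closed: "1 \<in> carrier (free_algebra X)"
  and fscalar_closed: "fscalar c \<in> carrier (free_algebra X)"
  and fvar_closed: "x \<in> X \<Longrightarrow> fvar x \<in> carrier (free_algebra X)"
  by (auto simp: carrier_free_algebra fscalar_def fvar_def zero_fword_def)

lemma free_algebra_sum_closed:
  "(\<And>x. x \<in> S \<Longrightarrow> f x \<in> carrier (free_algebra X)) \<Longrightarrow> sum f S \<in> carrier (free_algebra X)"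
  by (induction S rule: infinite_finite_induct)
    (simp_all add: free_algebra_zero_closed free_algebra_closed)

lemma free_algebra_prod_list_closed:
  "(\<And>x. x \<in> set xs \<Longrightarrow> x \<in> carrier (free_algebra X)) \<Longrightarrow> prod_list xs \<in> carrier (free_algebra X)"
  by (induction xs) (simp_all add: free_algebra_one_closed free_algebra_closed)

lemma free_algebra_power_closed:
  "x \<in> carrier (free_algebra X) \<Longrightarrow> x ^ (k::nat) \<in> carrier (free_algebra X)"
  by (induction k) (simp_all add: free_algebra_one_closed free_algebra_closed)

lemmas free_closed = free_algebra_closed free_algebra_zero_closed free_algebra_one_closed
  fscalar_closed fvar_closed free_algebra_sum_closed free_algebra_prod_list_closed
  free_algebra_uminus_closed free_algebra_power_closed

lemma qhalf_add: "qhalf (k + l) = qhalf k * qhalf l"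
  by (simp add: qhalf_def mult_single)

lemma qhalf_0: "qhalf 0 = 1"
  by (simp add: qhalf_def)

lemma fscalar_add: "fscalar (a + b) = fscalar a + fscalar b"
  and fscalar_diff: "fscalar (a - b) = fscalar a - fscalar b"
  and fscalar_mult: "fscalar (a * b) = fscalar a * fscalar b"
  and fscalar_one: "fscalar 1 = 1"
  and fscalar_zero: "fscalar 0 = 0"
  by (simp_all add: fscalar_def single_add single_diff mult_single)

lemma fscalar_comm: "fscalar c * p = p * fscalar c"
  by (induction p rule: poly_mapping_add_induct)
    (simp_all add: fscalar_def mult_single distrib_left distrib_right mult.commute)

lemma fscalar_left_comm: "p * (fscalar c * r) = fscalar c * (p * r)"
  by (simp only: mult.assoc[symmetric] fscalar_comm[of c p])

lemma single_fword: "Poly_Mapping.single (FWord ws) c = fscalar c * prod_list (map fvar ws)"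
proof -
  have "Poly_Mapping.single (FWord ws) (1::laurent) = prod_list (map fvar ws)"
  proof (induction ws)
    case (Cons a ws)
    have "Poly_Mapping.single (FWord (a # ws)) (1::laurent)
        = fvar a * Poly_Mapping.single (FWord ws) (1::laurent)"
      by (simp add: fvar_def mult_single plus_fword_def)
    then show ?case
      by (simp only: Cons.IH) simp
  qed (simp flip: zero_fword_def)
  then show ?thesis
    by (metis add.left_neutral fscalar_def mult.right_neutral mult_single)
qed

locale presentation =
  fixes X :: "'g set" and Rel :: "'g freealg set"
  assumes rel_closed: "Rel \<subseteq> carrier (free_algebra X)"
begin

abbreviation "F \<equiv> free_algebra X"
abbreviation "A \<equiv> presented_algebra X Rel"

definition "rel_ideal = Idl\<^bsub>F\<^esub> Rel"

definition "cls p = rel_ideal +>\<^bsub>F\<^esub> p"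

sublocale F: ring F by (rule free_algebra_ring)

sublocale I: ideal rel_ideal F
  unfolding rel_ideal_def by (rule F.genideal_ideal[OF rel_closed])

lemma rel_in_ideal: "r \<in> Rel \<Longrightarrow> r \<in> rel_ideal"
  unfolding rel_ideal_def using F.genideal_self[OF rel_closed] by blast

lemma ideal_zero: "0 \<in> rel_ideal"
  using I.zero_closed by simp

lemma ideal_add: "a \<in> rel_ideal \<Longrightarrow> b \<in> rel_ideal \<Longrightarrow> a + b \<in> rel_ideal"
  using I.a_closed by simp

lemma ideal_carrier: "a \<in> rel_ideal \<Longrightarrow> a \<in> carrier F"
  using I.a_Hcarr by simp

lemma ideal_mult_left: "a \<in> rel_ideal \<Longrightarrow> x \<in> carrier F \<Longrightarrow> x * a \<in> rel_ideal"
  and ideal_mult_right: "a \<in> rel_ideal \<Longrightarrow> x \<in> carrier F \<Longrightarrow> a * x \<in> rel_ideal"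
  using I.I_l_closed I.I_r_closed by simp_all

lemma ideal_uminus: "a \<in> rel_ideal \<Longrightarrow> - a \<in> rel_ideal"
  using I.a_inv_closed free_algebra_a_inv ideal_carrier by metis

text \<open>Computations are done on representatives modulo the ideal, where ordinary ring
  arithmetic applies, and are carried over to cosets by \<open>cls_eq_iff\<close>.\<close>

definition rel_cong (infix "\<approx>" 50) where
  "p \<approx> q \<longleftrightarrow> p - q \<in> rel_ideal"

lemma cong_refl [simp]: "p \<approx> p"
  by (simp add: rel_cong_def ideal_zero)

lemma cong_sym: "p \<approx> q \<Longrightarrow> q \<approx> p"
  unfolding rel_cong_def using ideal_uminus[of "p - q"] by simp

lemma cong_trans [trans]: "p \<approx> q \<Longrightarrow> q \<approx> r \<Longrightarrow> p \<approx> r"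
  unfolding rel_cong_def using ideal_add[of "p - q" "q - r"] by simp

lemma cong_add: "p \<approx> q \<Longrightarrow> p' \<approx> q' \<Longrightarrow> p + p' \<approx> q + q'"
  unfolding rel_cong_def using ideal_add[of "p - q" "p' - q'"] by (simp add: algebra_simps)

lemma cong_mult_left: "p \<approx> q \<Longrightarrow> x \<in> carrier F \<Longrightarrow> x * p \<approx> x * q"
  unfolding rel_cong_def by (simp add: ideal_mult_left flip: right_diff_distrib)

lemma cong_mult_right: "p \<approx> q \<Longrightarrow> x \<in> carrier F \<Longrightarrow> p * x \<approx> q * x"
  unfolding rel_cong_def by (simp add: ideal_mult_right flip: left_diff_distrib)

lemma cong_sum: "(\<And>x. x \<in> S \<Longrightarrow> f x \<approx> g x) \<Longrightarrow> sum f S \<approx> sum g S"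
  by (induction S rule: infinite_finite_induct) (simp_all add: cong_add)

lemma cls_eq_iff:
  assumes "p \<in> carrier F" "q \<in> carrier F"
  shows "cls p = cls q \<longleftrightarrow> p \<approx> q"
  using F.quotient_eq_iff_same_a_r_cos[OF I.ideal_axioms assms] assms
  by (simp add: cls_def rel_cong_def a_minus_def free_algebra_a_inv)

lemma presented_simps:
  "carrier A = carrier (F Quot rel_ideal)" "monoid.mult A = monoid.mult (F Quot rel_ideal)"
  "one A = one (F Quot rel_ideal)" "zero A = zero (F Quot rel_ideal)" "add A = add (F Quot rel_ideal)"
  "smult A = (\<lambda>c a. cls (fscalar c) \<otimes>\<^bsub>F Quot rel_ideal\<^esub> a)"
  by (simp_all add: presented_algebra_def Let_def rel_ideal_def cls_def)

lemma presented_ring: "ring A"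
proof -
  interpret Q: ring "F Quot rel_ideal" by (rule I.quotient_is_ring)
  show ?thesis
  proof (rule ringI)
    show "abelian_group A"
    proof (rule abelian_groupI)
      fix x assume "x \<in> carrier A"
      then show "\<exists>y\<in>carrier A. y \<oplus>\<^bsub>A\<^esub> x = \<zero>\<^bsub>A\<^esub>"
        unfolding presented_simps using Q.l_neg by blast
    qed (simp_all add: presented_simps Q.a_ac)
    show "monoid A"
      by (rule monoidI) (auto simp: presented_simps Q.m_assoc)
  qed (auto simp: presented_simps Q.l_distr Q.r_distr)
qed

sublocale A: ring A by (rule presented_ring)

lemma cls_closed: "p \<in> carrier F \<Longrightarrow> cls p \<in> carrier A"
  by (auto simp: presented_simps FactRing_def A_RCOSETS_def' cls_def)

lemma carrier_cls: "carrier A = cls ` carrier F"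
  by (auto simp: presented_simps FactRing_def A_RCOSETS_def' cls_def)

lemma cls_add: "p \<in> carrier F \<Longrightarrow> q \<in> carrier F \<Longrightarrow> cls p \<oplus>\<^bsub>A\<^esub> cls q = cls (p + q)"
  using I.a_rcos_sum[of p q] by (simp add: presented_simps FactRing_def cls_def)

lemma cls_mult: "p \<in> carrier F \<Longrightarrow> q \<in> carrier F \<Longrightarrow> cls p \<otimes>\<^bsub>A\<^esub> cls q = cls (p * q)"
  using I.rcoset_mult_add[of p q] by (simp add: presented_simps FactRing_def cls_def)

lemma cls_smult: "p \<in> carrier F \<Longrightarrow> c \<odot>\<^bsub>A\<^esub> cls p = cls (fscalar c * p)"
  using cls_mult[of "fscalar c" p] by (simp add: presented_simps fscalar_closed)

lemma cls_one: "\<one>\<^bsub>A\<^esub> = cls 1"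
  by (simp add: presented_simps FactRing_def cls_def)

lemma cls_zero: "\<zero>\<^bsub>A\<^esub> = cls 0"
  proof -
  have "cls 0 \<oplus>\<^bsub>A\<^esub> cls 0 = cls 0"
    using cls_add[of 0 0] by (simp add: free_closed)
  then show ?thesis
    by (metis A.add.l_cancel_one cls_closed free_algebra_zero_closed)
qed

lemma cls_prod_list:
  "(\<And>x. x \<in> set xs \<Longrightarrow> f x \<in> carrier F) \<Longrightarrow>
    list_prod A (map (\<lambda>x. cls (f x)) xs) = cls (prod_list (map f xs))"
proof (induction xs)
  case (Cons a xs)
  have "prod_list (map f xs) \<in> carrier F"
    using Cons.prems by (auto intro!: free_closed)
  then show ?case
    using Cons by (simp add: list_prod_def cls_mult)
qed (simp add: list_prod_def cls_one)

lemma cls_finsum: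
  assumes "\<And>x. x \<in> S \<Longrightarrow> f x \<in> carrier F" "finite S"
  shows "(\<Oplus>\<^bsub>A\<^esub>x\<in>S. cls (f x)) = cls (sum f S)"
  using assms(2,1)
  by induction (simp_all add: cls_zero cls_add free_closed cls_closed Pi_def)

lemma cls_power: "p \<in> carrier F \<Longrightarrow> cls p [^]\<^bsub>A\<^esub> (k::nat) = cls (p ^ k)"
  by (induction k) (simp_all add: cls_one cls_mult free_closed power_commutes)

lemma presented_gen_cls: "presented_gen X Rel g = cls (fvar g)"
  by (simp add: presented_gen_def cls_def rel_ideal_def)

section \<open>Scalars and linear spans in a presented algebra\<close>

lemma smult_closed: "a \<in> carrier A \<Longrightarrow> c \<odot>\<^bsub>A\<^esub> a \<in> carrier A"
  unfolding carrier_cls by (auto simp: cls_smult free_closed)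

lemma smult_add: "a \<in> carrier A \<Longrightarrow> (c + d) \<odot>\<^bsub>A\<^esub> a = c \<odot>\<^bsub>A\<^esub> a \<oplus>\<^bsub>A\<^esub> d \<odot>\<^bsub>A\<^esub> a"
  unfolding carrier_cls by (auto simp: cls_smult cls_add free_closed fscalar_add distrib_right)

lemma smult_one: "a \<in> carrier A \<Longrightarrow> 1 \<odot>\<^bsub>A\<^esub> a = a"
  unfolding carrier_cls by (auto simp: cls_smult fscalar_one)

lemma zero_in_span: "\<zero>\<^bsub>A\<^esub> \<in> linear_span A S"
  unfolding linear_span_def by (rule CollectI, rule exI[of _ "{}"]) simp

text \<open>A member of the span is a sum over a set, so a multiple of \<open>b\<close> has to be
  merged with a term at \<open>b\<close> that may already be present; \<open>e\<close> is the merged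
  coefficient.\<close>

lemma span_add_smult:
  assumes "S \<subseteq> carrier A" "x \<in> linear_span A S" "b \<in> S"
  shows "d \<odot>\<^bsub>A\<^esub> b \<oplus>\<^bsub>A\<^esub> x \<in> linear_span A S"
proof -
  obtain T c where T: "finite T" "T \<subseteq> S" and x: "x = (\<Oplus>\<^bsub>A\<^esub>b\<in>T. c b \<odot>\<^bsub>A\<^esub> b)"
    using assms(2) unfolding linear_span_def by blast
  let ?T = "T - {b}"
  let ?y = "\<Oplus>\<^bsub>A\<^esub>b\<in>?T. c b \<odot>\<^bsub>A\<^esub> b"
  have closed: "c b \<odot>\<^bsub>A\<^esub> b \<in> carrier A" if "b \<in> S" for b and c :: "'g freealg set \<Rightarrow> laurent"
    using that assms(1) smult_closed by blast
  define e where "e = (if b \<in> T then d + c b else d)"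
  have b: "b \<in> carrier A" using assms(1,3) by blast
  have y: "?y \<in> carrier A"
    using T(2) by (intro A.finsum_closed) (auto intro: closed)
  have "d \<odot>\<^bsub>A\<^esub> b \<oplus>\<^bsub>A\<^esub> x = e \<odot>\<^bsub>A\<^esub> b \<oplus>\<^bsub>A\<^esub> ?y"
  proof (cases "b \<in> T")
    case True
    then have "x = (\<Oplus>\<^bsub>A\<^esub>b\<in>insert b ?T. c b \<odot>\<^bsub>A\<^esub> b)"
      unfolding x by (simp add: insert_absorb)
    also have "\<dots> = c b \<odot>\<^bsub>A\<^esub> b \<oplus>\<^bsub>A\<^esub> ?y"
      using T assms(3) by (subst A.finsum_insert) (auto intro: closed)
    finally show ?thesis
      using True b y by (simp add: e_def smult_add A.a_assoc smult_closed)
  next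
    case False
    then show ?thesis by (simp add: x e_def)
  qed
  also have "\<dots> = (\<Oplus>\<^bsub>A\<^esub>b'\<in>insert b ?T. (c(b := e)) b' \<odot>\<^bsub>A\<^esub> b')"
  proof -
    have "?y = (\<Oplus>\<^bsub>A\<^esub>b'\<in>?T. (c(b := e)) b' \<odot>\<^bsub>A\<^esub> b')"
      using T(2) by (intro A.finsum_cong') (auto intro: closed)
    then show ?thesis
      using T assms(3) by (subst A.finsum_insert) (auto intro: closed)
  qed
  finally show ?thesis
    unfolding linear_span_def using T assms(3)
    by (intro CollectI exI[of _ "insert b ?T"] exI[of _ "c(b := e)"]) auto
qed

lemma smult_in_span: "S \<subseteq> carrier A \<Longrightarrow> b \<in> S \<Longrightarrow> c \<odot>\<^bsub>A\<^esub> b \<in> linear_span A S"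
  using span_add_smult[OF _ zero_in_span, of S b c] smult_closed[of b c] by auto

lemma base_in_span: "S \<subseteq> carrier A \<Longrightarrow> b \<in> S \<Longrightarrow> b \<in> linear_span A S"
  using smult_in_span[of S b 1] smult_one[of b] by auto

text \<open>The kernel of a homomorphism that kills the relations is an ideal containing them.\<close>

lemma hom_vanishes_on_ideal:
  fixes h :: "'g freealg \<Rightarrow> 'k::ring_1"
  assumes "\<And>p q. h (p + q) = h p + h q" "\<And>p q. h (p * q) = h p * h q"
    and "\<And>r. r \<in> Rel \<Longrightarrow> h r = 0" "p \<in> rel_ideal"
  shows "h p = 0"
proof -
  have zero: "h 0 = 0" using assms(1)[of 0 0] by simp
  have neg: "h (- p) = - h p" for p
    using assms(1)[of p "- p"] zero by (simp add: eq_neg_iff_add_eq_0 add.commute)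
  let ?J = "{p \<in> carrier F. h p = 0}"
  have "ideal ?J F"
  proof (rule idealI)
    show "ring F" by (rule free_algebra_ring)
    show "subgroup ?J (add_monoid F)"
    proof (rule group.subgroupI)
      show "group (add_monoid F)" using F.a_group .
      show "?J \<noteq> {}" using zero free_algebra_zero_closed by blast
      fix a assume a: "a \<in> ?J"
      then have "inv\<^bsub>add_monoid F\<^esub> a = - a"
        using free_algebra_a_inv[of a X] by (simp add: a_inv_def)
      with a show "inv\<^bsub>add_monoid F\<^esub> a \<in> ?J"
        by (simp add: neg free_closed)
    qed (auto simp: assms free_closed)
  qed (auto simp: assms free_closed)
  then have "rel_ideal \<subseteq> ?J"
    unfolding rel_ideal_def using F.genideal_minimal[of ?J Rel] assms(3) rel_closed by blast
  then show ?thesis using assms(4) by blast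
qed

end


section \<open>A quantum torus\<close>

text \<open>\<open>QMon k x\<close> stands for \<open>q^(k/2)\<close> times the product, in lexicographic order, of the edge
  variables in the multiset \<open>x\<close>. Bringing a product of two such monomials back into this form
  costs one factor \<open>q^(1/2)\<close> for each pair \<open>z(h,j,k), z(h',j,k)\<close> with \<open>h > h'\<close> in the wrong
  order, which is what \<open>cocycle\<close> counts.\<close>

datatype qmon = QMon int "(nat \<times> nat \<times> nat) multiset"

fun twist :: "nat \<times> nat \<times> nat \<Rightarrow> nat \<times> nat \<times> nat \<Rightarrow> int" where
  "twist (h, j, k) (h', j', k') = (if j = j' \<and> k = k' \<and> h' < h then 1 else 0)"

definition cocycle :: "(nat \<times> nat \<times> nat) multiset \<Rightarrow> (nat \<times> nat \<times> nat) multiset \<Rightarrow> int" where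
  "cocycle x y = (\<Sum>u\<in>#x. \<Sum>v\<in>#y. twist u v)"

lemma cocycle_empty [simp]: "cocycle {#} y = 0" "cocycle x {#} = 0"
  by (simp_all add: cocycle_def)

text \<open>Biadditivity makes \<open>cocycle\<close> a 2-cocycle, and this is what associativity of
  the twisted addition on \<open>qmon\<close> amounts to.\<close>

lemma cocycle_add:
  "cocycle (x + x') y = cocycle x y + cocycle x' y"
  "cocycle x (y + y') = cocycle x y + cocycle x y'"
  by (simp_all add: cocycle_def sum_mset.distrib)

lemma cocycle_eq_0: "(\<And>u v. u \<in># x \<Longrightarrow> v \<in># y \<Longrightarrow> twist u v = 0) \<Longrightarrow> cocycle x y = 0"
  unfolding cocycle_def by (simp cong: image_mset_cong)

lemma cocycle_single [simp]: "cocycle {#u#} {#v#} = twist u v"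
  by (simp add: cocycle_def)

instantiation qmon :: monoid_add
begin

definition zero_qmon :: qmon where
  "zero_qmon = QMon 0 {#}"

fun plus_qmon :: "qmon \<Rightarrow> qmon \<Rightarrow> qmon" where
  "plus_qmon (QMon a x) (QMon b y) = QMon (a + b + cocycle x y) (x + y)"

instance
proof
  fix a b c :: qmon
  show "a + b + c = a + (b + c)"
    by (cases a; cases b; cases c) (simp add: cocycle_add)
  show "0 + a = a" "a + 0 = a"
    by (cases a; simp add: zero_qmon_def)+
qed

end

text \<open>Powers of \<open>q^(1/2)\<close> sit in the monomials and the coefficients are plain
  integers; thus the torus is the monoid algebra of a twisted monoid, with its ring structure given
  by convolution.\<close>

type_synonym qtorus = "qmon \<Rightarrow>\<^sub>0 int"

definition qpow :: "int \<Rightarrow> qtorus" where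
  "qpow k = Poly_Mapping.single (QMon k {#}) 1"

definition qmonom :: "(nat \<times> nat \<times> nat) multiset \<Rightarrow> qtorus" where
  "qmonom x = Poly_Mapping.single (QMon 0 x) 1"

abbreviation zvar :: "nat \<times> nat \<times> nat \<Rightarrow> qtorus" where
  "zvar v \<equiv> qmonom {#v#}"

lemma qtorus_induct [case_names zero single add]:
  assumes "P 0" "\<And>k x c. P (Poly_Mapping.single (QMon k x) c)" "\<And>p q. P p \<Longrightarrow> P q \<Longrightarrow> P (p + q)"
  shows "P (p :: qtorus)"
proof (induction p rule: poly_mapping_add_induct)
  case (single k c)
  then show ?case by (cases k) (simp add: assms)
qed (simp_all add: assms)

lemma qpow_0 [simp]: "qpow 0 = 1"
  by (simp add: qpow_def flip: zero_qmon_def)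

lemma qpow_add: "qpow (a + b) = qpow a * qpow b"
  by (simp add: qpow_def mult_single)

lemma qpow_comm: "qpow k * x = x * qpow k"
  by (induction x rule: qtorus_induct)
    (simp_all add: qpow_def mult_single distrib_left distrib_right algebra_simps)

lemma of_int_qtorus: "(of_int i :: qtorus) = Poly_Mapping.single (QMon 0 {#}) i"
  by (metis single_of_int of_int_eq_id id_apply zero_qmon_def)

lemma of_int_comm_qtorus: "of_int i * x = x * (of_int i :: qtorus)"
  by (metis mult_of_int_commute)

definition qscalar :: "laurent \<Rightarrow> qtorus" where
  "qscalar = alg_eval of_int qpow"

interpretation qscalar_hom: monoid_algebra_hom "of_int :: int \<Rightarrow> qtorus" qpow
  by standard (simp_all add: qpow_add, rule of_int_comm_qtorus)

lemma qscalar_qhalf: "qscalar (qhalf k) = qpow k"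
  by (simp add: qscalar_def qhalf_def qscalar_hom.eval_single)

lemma qscalar_comm: "qscalar c * x = x * qscalar c"
  unfolding qscalar_def
proof (induction c rule: poly_mapping_add_induct)
  case (single k c)
  then show ?case
    unfolding qscalar_hom.eval_single by (metis mult.assoc qpow_comm of_int_comm_qtorus)
next
  case (add c d)
  show ?case
    by (simp only: qscalar_hom.eval_add distrib_left distrib_right add)
qed (simp add: qscalar_hom.eval_zero)

definition torus_eval :: "('g \<Rightarrow> qtorus) \<Rightarrow> 'g freealg \<Rightarrow> qtorus" where
  "torus_eval f = alg_eval qscalar (\<lambda>w. prod_list (map f (letters w)))"

interpretation torus_hom: monoid_algebra_hom qscalar "\<lambda>w. prod_list (map f (letters w))" for f :: "'g \<Rightarrow> qtorus"
  by standard
    (simp_all add: qscalar_def qscalar_hom.eval_add qscalar_hom.eval_mult qscalar_hom.eval_one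
      zero_fword_def plus_fword_def, metis qscalar_comm qscalar_def)

lemma torus_eval_simps:
  "torus_eval f (p + q) = torus_eval f p + torus_eval f q"
  "torus_eval f (p - q) = torus_eval f p - torus_eval f q"
  "torus_eval f (p * q) = torus_eval f p * torus_eval f q"
  "torus_eval f 1 = 1" "torus_eval f 0 = 0"
  "torus_eval f (sum F S) = (\<Sum>x\<in>S. torus_eval f (F x))"
  "torus_eval f (prod_list ps) = prod_list (map (torus_eval f) ps)"
  "torus_eval f (fvar x) = f x"
  "torus_eval f (fscalar c) = qscalar c"
  unfolding torus_eval_def
  by (rule torus_hom.eval_add torus_hom.eval_diff torus_hom.eval_mult torus_hom.eval_one
      torus_hom.eval_zero torus_hom.eval_sum torus_hom.eval_prod_list)+
    (simp_all add: fvar_def fscalar_def torus_hom.eval_single torus_hom.scalar_one zero_fword_def)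

lemma torus_eval_power: "torus_eval f (p ^ k) = torus_eval f p ^ k"
  by (induction k) (simp_all add: torus_eval_simps)

text \<open>Fixing the multiset and letting the power of \<open>q^(1/2)\<close> vary turns a family
  of integer coefficients back into one Laurent polynomial.\<close>

definition zcoeff :: "(nat \<times> nat \<times> nat) multiset \<Rightarrow> qtorus \<Rightarrow> laurent" where
  "zcoeff x p = Poly_Mapping.map_key (\<lambda>k. QMon k x) p"

lemma lookup_zcoeff: "Poly_Mapping.lookup (zcoeff x p) k = Poly_Mapping.lookup p (QMon k x)"
  by (simp add: zcoeff_def map_key.rep_eq inj_def)

lemma zcoeff_zero [simp]: "zcoeff x 0 = 0"
  by (rule poly_mapping_eqI) (simp add: lookup_zcoeff)

lemma zcoeff_add: "zcoeff x (p + q) = zcoeff x p + zcoeff x q"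
  by (rule poly_mapping_eqI) (simp add: lookup_zcoeff lookup_add)

lemma zcoeff_sum: "zcoeff x (sum f S) = (\<Sum>i\<in>S. zcoeff x (f i))"
  by (induction S rule: infinite_finite_induct) (simp_all add: zcoeff_add)

lemma zcoeff_single:
  "zcoeff x (Poly_Mapping.single (QMon k y) c) = (if x = y then Poly_Mapping.single k c else 0)"
  by (rule poly_mapping_eqI) (simp add: lookup_zcoeff lookup_single when_def)

lemma zcoeff_qmonom: "zcoeff x (qmonom y) = (if x = y then 1 else 0)"
  by (simp add: qmonom_def zcoeff_single)

lemma zcoeff_qscalar: "zcoeff x (qscalar c * p) = c * zcoeff x p"
proof (induction c rule: poly_mapping_add_induct)
  case (single k c)
  show ?case
  proof (induction p rule: qtorus_induct)
    case (single l y d)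
    then show ?case
      by (simp add: qscalar_def qscalar_hom.eval_single of_int_qtorus qpow_def mult_single zcoeff_single)
  qed (simp_all add: zcoeff_add distrib_left)
qed (simp_all add: qscalar_def qscalar_hom.eval_zero qscalar_hom.eval_add zcoeff_add distrib_right)

lemma zcoeff_qpow: "zcoeff x (qpow k * p) = qhalf k * zcoeff x p"
  using zcoeff_qscalar[of x "qhalf k" p] by (simp add: qscalar_qhalf)

text \<open>Only terms over the multiset \<open>x\<close> can land on \<open>x + y\<close>, and
  reordering shifts the exponent of each of them by the same amount.\<close>

lemma zcoeff_mult_qmonom:
  "zcoeff (x + y) (p * qmonom y) = qhalf (cocycle x y) * zcoeff x p"
  by (induction p rule: qtorus_induct)
    (simp_all add: zcoeff_add distrib_left distrib_right qmonom_def mult_single zcoeff_single qhalf_def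
      add.commute)

lemma zcoeff_mult_qmonom_eq_0: "\<not> y \<subseteq># x \<Longrightarrow> zcoeff x (p * qmonom y) = 0"
  by (induction p rule: qtorus_induct)
    (auto simp add: zcoeff_add distrib_right qmonom_def mult_single zcoeff_single)

lemma qmonom_mult: "qmonom x * qmonom y = qpow (cocycle x y) * qmonom (x + y)"
  by (simp add: qmonom_def qpow_def mult_single)

lemma zvar_comm:
  assumes "j \<noteq> j' \<or> k \<noteq> k'"
  shows "zvar (h, j, k) * zvar (h', j', k') = zvar (h', j', k') * zvar (h, j, k)"
  using assms by (auto simp: qmonom_mult add_mset_commute)

lemma zvar_q_comm: "zvar (Suc s, j, k) * zvar (s, j, k) = qpow 1 * zvar (s, j, k) * zvar (Suc s, j, k)"
  by (simp add: qmonom_mult mult.assoc add_mset_commute)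


section \<open>The monomial basis of the algebra of edge weights\<close>

lemma sorted_wrt_concat_map:
  assumes "sorted_wrt Q xs" "\<And>x. x \<in> set xs \<Longrightarrow> sorted_wrt R (f x)"
    and "\<And>x y a b. x \<in> set xs \<Longrightarrow> y \<in> set xs \<Longrightarrow> Q x y \<Longrightarrow> a \<in> set (f x) \<Longrightarrow> b \<in> set (f y) \<Longrightarrow> R a b"
  shows "sorted_wrt R (concat (map f xs))"
  using assms
proof (induction xs)
  case (Cons x xs)
  have "sorted_wrt R (concat (map f xs))"
    by (rule Cons.IH) (use Cons.prems in \<open>simp_all, blast\<close>)
  moreover have "R a b" if "a \<in> set (f x)" "b \<in> set (concat (map f xs))" for a b
    using that Cons.prems by fastforce
  ultimately show ?case
    using Cons.prems by (simp add: sorted_wrt_append)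
qed simp

definition lex_less :: "nat \<times> nat \<times> nat \<Rightarrow> nat \<times> nat \<times> nat \<Rightarrow> bool" where
  "lex_less = (\<lambda>(h, j, k) (h', j', k'). h < h' \<or> h = h' \<and> (j < j' \<or> j = j' \<and> k < k'))"

lemma sorted_wire_vars: "sorted_wrt lex_less (wire_vars n ss)"
  unfolding wire_vars_def
proof (rule sorted_wrt_concat_map[where Q = "(<)"], goal_cases)
  case (2 h)
  show ?case
  proof (rule sorted_wrt_concat_map[where Q = "(<)"], goal_cases)
    case (2 j)
    show ?case by (simp add: lex_less_def)
  qed (auto simp: lex_less_def split: if_splits simp del: upt_Suc)
qed (auto simp: lex_less_def split: if_splits simp del: upt_Suc)

lemma distinct_wire_vars: "distinct (wire_vars n ss)"
proof -
  have "distinct vs" if "sorted_wrt lex_less vs" for vs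
    using that by (induction vs) (auto simp: lex_less_def)
  then show ?thesis using sorted_wire_vars .
qed

lemma set_wire_vars:
  "(h, j, k) \<in> set (wire_vars n ss) \<longleftrightarrow>
     h \<in> {1..n} \<and> j \<in> {1..length ss} \<and> h \<in> crossing_levels ss j \<and> k \<in> {1, 2}"
  by (auto simp: wire_vars_def split: if_splits)

definition expo_mset :: "(nat \<times> nat \<times> nat) list \<Rightarrow> (nat \<times> nat \<times> nat \<Rightarrow> nat) \<Rightarrow> (nat \<times> nat \<times> nat) multiset" where
  "expo_mset vs a = sum_list (map (\<lambda>v. replicate_mset (a v) v) vs)"

lemma count_expo_mset:
  "distinct vs \<Longrightarrow> count (expo_mset vs a) v = (if v \<in> set vs then a v else 0)"
  by (induction vs) (auto simp: expo_mset_def)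

lemma set_expo_mset: "v \<in># expo_mset vs a \<Longrightarrow> v \<in> set vs"
  by (induction vs) (auto simp: expo_mset_def split: if_splits)

lemma twist_self [simp]: "twist v v = 0"
  by (cases v) simp

lemma zvar_power: "zvar v ^ k = qmonom (replicate_mset k v)"
proof (induction k)
  case 0
  show ?case by (simp add: qmonom_def flip: zero_qmon_def)
next
  case (Suc k)
  have "cocycle {#v#} (replicate_mset k v) = 0"
    by (rule cocycle_eq_0) (auto split: if_splits)
  with Suc show ?case by (simp add: qmonom_mult)
qed

text \<open>No power of \<open>q^(1/2)\<close> appears because \<open>twist\<close> counts only
  pairs in which the larger level comes first, and an increasing list has none with equal
  \<open>j\<close> and \<open>k\<close>.\<close>

lemma ordered_zvar_product:
  "sorted_wrt lex_less vs \<Longrightarrow> prod_list (map (\<lambda>v. zvar v ^ a v) vs) = qmonom (expo_mset vs a)"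
proof (induction vs)
  case Nil
  show ?case by (simp add: qmonom_def expo_mset_def flip: zero_qmon_def)
next
  case (Cons v vs)
  have "cocycle (replicate_mset (a v) v) (expo_mset vs a) = 0"
    by (rule cocycle_eq_0)
      (use Cons.prems in \<open>auto split: if_splits simp: lex_less_def dest!: set_expo_mset\<close>)
  with Cons show ?case by (simp add: zvar_power qmonom_mult expo_mset_def)
qed

locale wiring =
  fixes n :: nat and ss :: "nat list"
  assumes expr: "is_expression n ss"
begin

lemma crossing_bounds: "j \<in> {1..length ss} \<Longrightarrow> crossing ss j \<in> {1..<n}"
  using expr nth_mem[of "j - 1" ss] unfolding is_expression_def crossing_def by fastforce

abbreviation "vars \<equiv> set (wire_vars n ss)"

lemma crossing_vars:
  "j \<in> {1..length ss} \<Longrightarrow> k \<in> {1, 2} \<Longrightarrow> (crossing ss j, j, k) \<in> vars"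
  "j \<in> {1..length ss} \<Longrightarrow> k \<in> {1, 2} \<Longrightarrow> (Suc (crossing ss j), j, k) \<in> vars"
  using crossing_bounds[of j] by (auto simp: set_wire_vars crossing_levels_def)

sublocale presentation vars "wire_rels n ss"
proof
  show "wire_rels n ss \<subseteq> carrier (free_algebra vars)"
    unfolding wire_rels_def
    by (auto intro!: free_closed crossing_vars)
qed

notation rel_cong (infix "\<approx>" 50)

lemma wire_algebra: "wire_algebra n ss = A"
  by (simp add: wire_algebra_def)

lemma wire_z: "wire_z n ss v = cls (fvar v)"
  by (simp add: wire_z_def presented_gen_cls)

lemma torus_eval_rel: "r \<in> wire_rels n ss \<Longrightarrow> torus_eval zvar r = 0"
proof -
  assume "r \<in> wire_rels n ss"
  then consider (comm) h j k h' j' k' where "j \<noteq> j' \<or> k \<noteq> k'"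
      "r = fvar (h, j, k) * fvar (h', j', k') - fvar (h', j', k') * fvar (h, j, k)"
    | (q_comm) s j k where "r = fvar (Suc s, j, k) * fvar (s, j, k)
        - fscalar (qhalf 1) * fvar (s, j, k) * fvar (Suc s, j, k)"
    unfolding wire_rels_def by blast
  then show ?thesis
  proof cases
    case comm
    then show ?thesis by (simp add: torus_eval_simps zvar_comm[OF comm(1)])
  next
    case q_comm
    then show ?thesis by (simp add: torus_eval_simps qscalar_qhalf zvar_q_comm)
  qed
qed

text \<open>Makes the value in the torus an invariant of cosets, so that independence of the ordered
  monomials can be tested there.\<close>

lemma torus_eval_cong: "p \<approx> p' \<Longrightarrow> torus_eval zvar p = torus_eval zvar p'"
  using hom_vanishes_on_ideal[of "torus_eval zvar" "p - p'"] torus_eval_rel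
  by (simp add: torus_eval_simps rel_cong_def)

section \<open>Ordered monomials and reordering up to powers of q\<close>

definition ordered_monom :: "(nat \<times> nat \<times> nat \<Rightarrow> nat) \<Rightarrow> (nat \<times> nat \<times> nat) freealg" where
  "ordered_monom a = prod_list (map (\<lambda>v. fvar v ^ a v) (wire_vars n ss))"

lemma ordered_monom_closed: "ordered_monom a \<in> carrier F"
  unfolding ordered_monom_def by (auto intro!: free_closed)

lemma wire_monom: "wire_monom n ss a = cls (ordered_monom a)"
proof -
  have "map (\<lambda>v. wire_z n ss v [^]\<^bsub>A\<^esub> a v) (wire_vars n ss)
      = map (\<lambda>v. cls (fvar v ^ a v)) (wire_vars n ss)"
    by (simp add: wire_z cls_power free_closed)
  then show ?thesis
    unfolding wire_monom_def ordered_monom_def wire_algebra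
    by (simp only:) (simp add: cls_prod_list free_closed)
qed

lemma torus_eval_ordered_monom:
  "torus_eval zvar (ordered_monom a) = qmonom (expo_mset (wire_vars n ss) a)"
  by (simp add: ordered_monom_def torus_eval_simps torus_eval_power comp_def
      ordered_zvar_product[OF sorted_wire_vars])

text \<open>Spanning depends only on the exponents of the variables, so the power of
  \<open>q^(1/2)\<close> produced by reordering is left unspecified.\<close>

definition q_cong (infix "\<sim>" 50) where
  "p \<sim> p' \<longleftrightarrow> (\<exists>k. p \<approx> fscalar (qhalf k) * p')"

lemma q_cong_refl [simp]: "p \<sim> p"
  unfolding q_cong_def by (rule exI[of _ 0]) (simp add: qhalf_0 fscalar_one)

lemma q_cong_trans [trans]:
  assumes "p \<sim> p'" "p' \<sim> p''"
  shows "p \<sim> p''"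
proof -
  obtain k l where k: "p \<approx> fscalar (qhalf k) * p'" and l: "p' \<approx> fscalar (qhalf l) * p''"
    using assms unfolding q_cong_def by blast
  have "p \<approx> fscalar (qhalf k) * (fscalar (qhalf l) * p'')"
    using cong_trans[OF k cong_mult_left[OF l fscalar_closed]] .
  then show ?thesis
    unfolding q_cong_def by (metis qhalf_add fscalar_mult mult.assoc)
qed

lemma q_cong_mult_left: "p \<sim> p' \<Longrightarrow> x \<in> carrier F \<Longrightarrow> x * p \<sim> x * p'"
  unfolding q_cong_def using cong_mult_left[of p _ x]
  by (metis (no_types, lifting) fscalar_comm mult.assoc)

lemma q_cong_mult_right: "p \<sim> p' \<Longrightarrow> x \<in> carrier F \<Longrightarrow> p * x \<sim> p' * x"
  unfolding q_cong_def using cong_mult_right[of p _ x]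
  by (metis (no_types, lifting) mult.assoc)

lemma q_cong_fvar_swap:
  assumes u: "u \<in> vars" and v: "v \<in> vars"
  shows "fvar u * fvar v \<sim> fvar v * fvar u"
proof -
  obtain h j k h' j' k' where uv: "u = (h, j, k)" "v = (h', j', k')" by (cases u; cases v)
  \<comment> \<open>Two variables that share \<open>j\<close> and \<open>k\<close> differ at most in
    their level, and a crossing has only two levels.\<close>
  consider "j \<noteq> j' \<or> k \<noteq> k'" | "u = v" | "j = j'" "k = k'" "h = Suc (crossing ss j)" "h' = crossing ss j"
    | "j = j'" "k = k'" "h' = Suc (crossing ss j)" "h = crossing ss j"
    using u v uv by (auto simp: set_wire_vars crossing_levels_def)
  then show ?thesis
  proof cases
    case 1
    then have "fvar u * fvar v - fvar v * fvar u \<in> wire_rels n ss"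
      using u v uv unfolding wire_rels_def by blast
    then have "fvar u * fvar v \<approx> fvar v * fvar u"
      by (simp add: rel_cong_def rel_in_ideal)
    then show ?thesis
      unfolding q_cong_def by (intro exI[of _ 0]) (simp add: qhalf_0 fscalar_one)
  next
    case 3
    then have "fvar u * fvar v - fscalar (qhalf 1) * fvar v * fvar u \<in> wire_rels n ss"
      using u v uv unfolding wire_rels_def by (auto simp: set_wire_vars)
    then show ?thesis
      unfolding q_cong_def rel_cong_def
      by (intro exI[of _ 1]) (simp add: rel_in_ideal flip: mult.assoc)
  next
    case 4
    then have "fvar v * fvar u - fscalar (qhalf 1) * fvar u * fvar v \<in> wire_rels n ss"
      using u v uv unfolding wire_rels_def by (auto simp: set_wire_vars)
    then have "fvar v * fvar u \<approx> fscalar (qhalf 1) * (fvar u * fvar v)"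
      unfolding rel_cong_def by (simp add: rel_in_ideal flip: mult.assoc)
    from cong_mult_left[OF cong_sym[OF this] fscalar_closed, of "qhalf (-1)"]
    have "fvar u * fvar v \<approx> fscalar (qhalf (-1)) * (fvar v * fvar u)"
      by (simp flip: mult.assoc fscalar_mult qhalf_add) (simp add: qhalf_0 fscalar_one)
    then show ?thesis unfolding q_cong_def by blast
  qed simp
qed

lemma q_cong_move:
  assumes "v \<in> vars" "set ps \<subseteq> fvar ` vars"
  shows "fvar v * prod_list ps \<sim> prod_list ps * fvar v"
  using assms(2)
proof (induction ps)
  case (Cons p ps)
  then obtain u where u: "u \<in> vars" "p = fvar u" by auto
  have ps: "prod_list ps \<in> carrier F"
    using Cons.prems by (auto intro!: free_closed)
  have "fvar v * (fvar u * prod_list ps) \<sim> fvar u * (fvar v * prod_list ps)"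
    using q_cong_mult_right[OF q_cong_fvar_swap[OF assms(1) u(1)] ps] by (simp add: mult.assoc)
  also have "fvar u * (fvar v * prod_list ps) \<sim> fvar u * (prod_list ps * fvar v)"
    using q_cong_mult_left[OF Cons.IH] Cons.prems u by (auto intro!: free_closed)
  finally show ?case
    by (simp add: u mult.assoc)
qed simp

lemma fvar_mult_ordered_monom:
  assumes "v \<in> vars"
  shows "fvar v * ordered_monom a \<sim> ordered_monom (a(v := Suc (a v)))"
proof -
  obtain l r where lr: "wire_vars n ss = l @ v # r"
    using split_list[OF assms] by blast
  have notin: "v \<notin> set l" "v \<notin> set r"
    using distinct_wire_vars[of n ss] unfolding lr by auto
  let ?P = "\<lambda>vs. prod_list (map (\<lambda>v. fvar v ^ a v) vs)"
  \<comment> \<open>Powers are unfolded into words, since \<open>q_cong_move\<close> passes a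
    variable through a product of single variables.\<close>
  have P: "?P vs = prod_list (concat (map (\<lambda>v. replicate (a v) (fvar v)) vs))" for vs
    by (induction vs) simp_all
  have "fvar v * ?P l \<sim> ?P l * fvar v"
    unfolding P by (rule q_cong_move) (use assms lr in \<open>auto split: if_splits\<close>)
  moreover have "fvar v ^ a v * ?P r \<in> carrier F"
    using lr assms by (auto intro!: free_closed)
  ultimately have "fvar v * ?P l * (fvar v ^ a v * ?P r) \<sim> ?P l * fvar v * (fvar v ^ a v * ?P r)"
    by (rule q_cong_mult_right)
  moreover have "map (\<lambda>u. fvar u ^ (a(v := Suc (a v))) u) l = map (\<lambda>v. fvar v ^ a v) l"
    "map (\<lambda>u. fvar u ^ (a(v := Suc (a v))) u) r = map (\<lambda>v. fvar v ^ a v) r"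
    using notin by auto
  ultimately show ?thesis
    unfolding ordered_monom_def lr by (simp add: mult.assoc del: map_eq_conv)
qed

lemma word_q_cong_ordered_monom:
  "set ws \<subseteq> vars \<Longrightarrow> \<exists>a\<in>wire_exponents n ss. prod_list (map fvar ws) \<sim> ordered_monom a"
proof (induction ws)
  case Nil
  have "ordered_monom (\<lambda>_. 0) = 1"
    by (simp add: ordered_monom_def map_replicate_const)
  then show ?case
    by (intro bexI[of _ "\<lambda>_. 0"]) (simp_all add: wire_exponents_def)
next
  case (Cons v ws)
  then obtain a where a: "a \<in> wire_exponents n ss" "prod_list (map fvar ws) \<sim> ordered_monom a"
    by auto
  have "fvar v * prod_list (map fvar ws) \<sim> fvar v * ordered_monom a"
    using q_cong_mult_left[OF a(2)] Cons.prems by (simp add: free_closed)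
  also have "\<dots> \<sim> ordered_monom (a(v := Suc (a v)))"
    using fvar_mult_ordered_monom Cons.prems by simp
  finally show ?case
    using a(1) Cons.prems
    by (intro bexI[of _ "a(v := Suc (a v))"]) (auto simp: wire_exponents_def simp del: fun_upd_apply, auto)
qed

section \<open>Existence and uniqueness of the expansion in ordered monomials\<close>

definition lin_comb :: "((nat \<times> nat \<times> nat \<Rightarrow> nat) \<Rightarrow>\<^sub>0 laurent) \<Rightarrow> (nat \<times> nat \<times> nat) freealg" where
  "lin_comb c = (\<Sum>a\<in>Poly_Mapping.keys c. fscalar (Poly_Mapping.lookup c a) * ordered_monom a)"

lemma lin_comb_add: "lin_comb (c + d) = lin_comb c + lin_comb d"
  unfolding lin_comb_def
  by (rule setsum_keys_plus_distrib) (simp_all add: fscalar_zero fscalar_add distrib_right)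

lemma lin_comb_closed: "lin_comb c \<in> carrier F"
  unfolding lin_comb_def by (intro free_closed ordered_monom_closed)

lemma lin_comb_single: "lin_comb (Poly_Mapping.single a c) = fscalar c * ordered_monom a"
  by (cases "c = 0") (simp_all add: lin_comb_def fscalar_zero)

text \<open>The spanning half of the basis property: each word reorders to one ordered monomial, and
  the unspecified power of \<open>q^(1/2)\<close> is absorbed into its coefficient.\<close>

lemma cong_lin_comb:
  assumes "p \<in> carrier F"
  shows "\<exists>c. Poly_Mapping.keys c \<subseteq> wire_exponents n ss \<and> p \<approx> lin_comb c"
proof -
  have "\<exists>c. Poly_Mapping.keys c \<subseteq> wire_exponents n ss \<and>
      (\<Sum>w\<in>S. Poly_Mapping.single w (Poly_Mapping.lookup p w)) \<approx> lin_comb c"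
    if "finite S" "S \<subseteq> Poly_Mapping.keys p" for S
    using that
  proof induction
    case empty
    show ?case by (rule exI[of _ 0]) (simp add: lin_comb_def)
  next
    case (insert w S)
    obtain c where c: "Poly_Mapping.keys c \<subseteq> wire_exponents n ss"
      "(\<Sum>w\<in>S. Poly_Mapping.single w (Poly_Mapping.lookup p w)) \<approx> lin_comb c"
      using insert by auto
    have "set (letters w) \<subseteq> vars"
      using insert.prems assms by (auto simp: carrier_free_algebra)
    then obtain a k where a: "a \<in> wire_exponents n ss"
      "prod_list (map fvar (letters w)) \<approx> fscalar (qhalf k) * ordered_monom a"
      using word_q_cong_ordered_monom unfolding q_cong_def by blast
    let ?x = "Poly_Mapping.lookup p w"
    have "Poly_Mapping.single w ?x = fscalar ?x * prod_list (map fvar (letters w))"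
      using single_fword[of "letters w"] by simp
    also have "\<dots> \<approx> fscalar ?x * (fscalar (qhalf k) * ordered_monom a)"
      using cong_mult_left[OF a(2) fscalar_closed] .
    also have "\<dots> = lin_comb (Poly_Mapping.single a (?x * qhalf k))"
      by (simp add: lin_comb_single fscalar_mult mult.assoc)
    finally have "Poly_Mapping.single w ?x + (\<Sum>w\<in>S. Poly_Mapping.single w (Poly_Mapping.lookup p w))
        \<approx> lin_comb (Poly_Mapping.single a (?x * qhalf k) + c)"
      unfolding lin_comb_add using c(2) by (rule cong_add)
    moreover have "Poly_Mapping.keys (Poly_Mapping.single a (?x * qhalf k) + c) \<subseteq> wire_exponents n ss"
      using a(1) c(1) Poly_Mapping.keys_add[of "Poly_Mapping.single a (?x * qhalf k)" c]
      by (auto split: if_splits)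
    ultimately show ?case
      using insert.hyps by (auto intro!: exI)
  qed
  from this[of "Poly_Mapping.keys p"] show ?thesis
    by (simp add: poly_mapping_sum_singles)
qed

lemma expo_mset_inj:
  assumes "a \<in> wire_exponents n ss" "b \<in> wire_exponents n ss"
    "expo_mset (wire_vars n ss) a = expo_mset (wire_vars n ss) b"
  shows "a = b"
proof
  fix v
  show "a v = b v"
    using arg_cong[OF assms(3), of "\<lambda>x. count x v"] assms(1,2)
    by (auto simp: count_expo_mset[OF distinct_wire_vars] wire_exponents_def split: if_splits
        simp del: split_paired_All)
qed

text \<open>The independence half: different exponent functions give different multisets, so in the
  torus each coefficient can be read off by itself.\<close>

lemma zcoeff_lin_comb:
  assumes "Poly_Mapping.keys c \<subseteq> wire_exponents n ss" "a \<in> wire_exponents n ss"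
  shows "zcoeff (expo_mset (wire_vars n ss) a) (torus_eval zvar (lin_comb c)) = Poly_Mapping.lookup c a"
proof -
  have "zcoeff (expo_mset (wire_vars n ss) a) (torus_eval zvar (lin_comb c))
      = (\<Sum>b\<in>Poly_Mapping.keys c. if b = a then Poly_Mapping.lookup c b else 0)"
    unfolding lin_comb_def torus_eval_simps zcoeff_sum zcoeff_qscalar torus_eval_ordered_monom zcoeff_qmonom
    by (rule sum.cong) (use assms expo_mset_inj in \<open>auto\<close>)
  then show ?thesis by (simp add: in_keys_iff)
qed

lemma cls_lin_comb:
  assumes "Poly_Mapping.keys c \<subseteq> wire_exponents n ss"
  shows "(\<Oplus>\<^bsub>A\<^esub>a\<in>Poly_Mapping.keys c. Poly_Mapping.lookup c a \<odot>\<^bsub>A\<^esub> wire_monom n ss a) = cls (lin_comb c)"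
  unfolding lin_comb_def wire_monom
  by (simp add: cls_smult ordered_monom_closed cls_finsum free_closed)

text \<open>The definite description in \<open>basis_coeffs\<close> denotes only if the expansion
  exists and is unique. Spanning provides it, and any two expansions of one coset have the same
  value in the torus, which determines every coefficient.\<close>

lemma zG_coeff_cls:
  assumes "p \<in> carrier F"
  shows "zG_coeff n ss (cls p) = zcoeff (mset (wire_vars n ss)) (torus_eval zvar p)"
proof -
  obtain c where c: "Poly_Mapping.keys c \<subseteq> wire_exponents n ss" "p \<approx> lin_comb c"
    using cong_lin_comb[OF assms] by blast
  have "basis_coeffs A (wire_exponents n ss) (wire_monom n ss) (cls p) = c"
    unfolding basis_coeffs_def
  proof (rule the_equality)
    show "Poly_Mapping.keys c \<subseteq> wire_exponents n ss \<and>
      cls p = (\<Oplus>\<^bsub>A\<^esub>i\<in>Poly_Mapping.keys c. Poly_Mapping.lookup c i \<odot>\<^bsub>A\<^esub> wire_monom n ss i)"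
      using c assms by (simp add: cls_lin_comb cls_eq_iff lin_comb_closed)
    fix d
    assume d: "Poly_Mapping.keys d \<subseteq> wire_exponents n ss \<and>
      cls p = (\<Oplus>\<^bsub>A\<^esub>i\<in>Poly_Mapping.keys d. Poly_Mapping.lookup d i \<odot>\<^bsub>A\<^esub> wire_monom n ss i)"
    then have "cls p = cls (lin_comb d)"
      by (simp add: cls_lin_comb)
    then have "p \<approx> lin_comb d"
      using assms by (simp add: cls_eq_iff lin_comb_closed)
    then have ev: "torus_eval zvar (lin_comb d) = torus_eval zvar (lin_comb c)"
      using c(2) torus_eval_cong by metis
    show "d = c"
    proof (rule poly_mapping_eqI)
      fix a
      show "Poly_Mapping.lookup d a = Poly_Mapping.lookup c a"
      proof (cases "a \<in> wire_exponents n ss")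
        case True
        then show ?thesis
          using zcoeff_lin_comb[of c a] zcoeff_lin_comb[of d a] c(1) d ev by simp
      next
        case False
        then have "a \<notin> Poly_Mapping.keys c" "a \<notin> Poly_Mapping.keys d"
          using c(1) d by auto
        then show ?thesis by (simp add: in_keys_iff)
      qed
    qed
  qed
  moreover have "expo_mset (wire_vars n ss) (\<lambda>v. if v \<in> vars then 1 else 0) = mset (wire_vars n ss)"
    by (rule multiset_eqI)
      (use distinct_wire_vars[of n ss] in \<open>simp add: count_expo_mset distinct_count_atmost_1
        del: split_paired_All\<close>)
  ultimately show ?thesis
    using zcoeff_lin_comb[OF c(1), of "\<lambda>v. if v \<in> vars then 1 else 0"] torus_eval_cong[OF c(2)]
    by (simp add: zG_coeff_def wire_algebra wire_exponents_def)
qed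

end


section \<open>Quantum matrices column by column\<close>

definition q_delta :: qtorus where
  "q_delta = qpow 1 - qpow (-1)"

definition q_column :: "(nat \<Rightarrow> qtorus) \<Rightarrow> bool" where
  "q_column X \<longleftrightarrow> (\<forall>i j. i < j \<longrightarrow> X j * X i = qpow 1 * (X i * X j))"

text \<open>The relations of the quantum matrix bialgebra that involve a left column
  \<open>X\<close> and a right column \<open>Y\<close>; \<open>q_column\<close> is the one inside a
  column. Sorting them by columns suits a crossing, which changes two columns and leaves the rows
  alone.\<close>

definition q_columns :: "(nat \<Rightarrow> qtorus) \<Rightarrow> (nat \<Rightarrow> qtorus) \<Rightarrow> bool" where
  "q_columns X Y \<longleftrightarrow> (\<forall>i. Y i * X i = qpow 1 * (X i * Y i)) \<and>
     (\<forall>i j. i < j \<longrightarrow> X j * Y i = Y i * X j \<and> Y j * X i = X i * Y j + q_delta * (Y i * X j))"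

lemma q_columnD: "q_column X \<Longrightarrow> i < j \<Longrightarrow> X j * X i = qpow 1 * (X i * X j)"
  by (simp add: q_column_def)

lemma q_columnsD:
  assumes "q_columns X Y"
  shows "Y i * X i = qpow 1 * (X i * Y i)"
    and "i < j \<Longrightarrow> X j * Y i = Y i * X j"
    and "i < j \<Longrightarrow> Y j * X i = X i * Y j + q_delta * (Y i * X j)"
  using assms by (simp_all add: q_columns_def)

lemma mult_assoc_lift: "a * b = c \<Longrightarrow> a * (b * z) = c * (z :: 'a :: semigroup_mult)"
  by (simp flip: mult.assoc)

lemma qpow_left_comm: "x * (qpow k * y) = qpow k * (x * y)"
  by (metis qpow_comm mult.assoc)

lemma q_delta_left_comm: "x * (q_delta * y) = q_delta * (x * y)"
  by (simp add: q_delta_def left_diff_distrib right_diff_distrib qpow_left_comm)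

lemma q_delta_qpow:
  "q_delta * (qpow 1 * x) = qpow 1 * (qpow 1 * x) - x"
  "qpow 1 * (q_delta * x) = qpow 1 * (qpow 1 * x) - x"
  by (simp_all add: q_delta_def left_diff_distrib right_diff_distrib flip: mult.assoc qpow_add)

lemmas q_expand = distrib_left distrib_right mult.assoc qpow_left_comm q_delta_left_comm

text \<open>The relations are linear in each column separately, so the coefficients have to commute
  only with the entries of the column that stays fixed.\<close>

lemma q_columns_comb_right:
  assumes XY: "q_columns X Y" and XZ: "q_columns X Z"
    and p: "\<And>i. p * X i = X i * p" and p': "\<And>i. p' * X i = X i * p'"
  shows "q_columns X (\<lambda>i. Y i * p + Z i * p')"
  unfolding q_columns_def
proof (intro conjI allI impI)
  fix i j :: nat
  show "(Y i * p + Z i * p') * X i = qpow 1 * (X i * (Y i * p + Z i * p'))"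
    by (simp add: q_expand p p' mult_assoc_lift[OF q_columnsD(1)[OF XY]]
        mult_assoc_lift[OF q_columnsD(1)[OF XZ]])
  assume ij: "i < j"
  show "X j * (Y i * p + Z i * p') = (Y i * p + Z i * p') * X j"
    by (simp add: q_expand p p' mult_assoc_lift[OF q_columnsD(2)[OF XY ij]]
        mult_assoc_lift[OF q_columnsD(2)[OF XZ ij]])
  show "(Y j * p + Z j * p') * X i = X i * (Y j * p + Z j * p') + q_delta * ((Y i * p + Z i * p') * X j)"
    by (simp add: q_expand p p' mult_assoc_lift[OF q_columnsD(3)[OF XY ij]]
        mult_assoc_lift[OF q_columnsD(3)[OF XZ ij]] add_ac)
qed

lemma q_columns_comb_left:
  assumes XZ: "q_columns X Z" and YZ: "q_columns Y Z"
    and p: "\<And>i. p * Z i = Z i * p" and p': "\<And>i. p' * Z i = Z i * p'"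
  shows "q_columns (\<lambda>i. X i * p + Y i * p') Z"
  unfolding q_columns_def
proof (intro conjI allI impI)
  fix i j :: nat
  show "Z i * (X i * p + Y i * p') = qpow 1 * ((X i * p + Y i * p') * Z i)"
    by (simp add: q_expand p p' mult_assoc_lift[OF q_columnsD(1)[OF XZ]]
        mult_assoc_lift[OF q_columnsD(1)[OF YZ]])
  assume ij: "i < j"
  show "(X j * p + Y j * p') * Z i = Z i * (X j * p + Y j * p')"
    by (simp add: q_expand p p' mult_assoc_lift[OF q_columnsD(2)[OF XZ ij]]
        mult_assoc_lift[OF q_columnsD(2)[OF YZ ij]])
  show "Z j * (X i * p + Y i * p') = (X i * p + Y i * p') * Z j + q_delta * (Z i * (X j * p + Y j * p'))"
    by (simp add: q_expand p p' mult_assoc_lift[OF q_columnsD(3)[OF XZ ij]]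
        mult_assoc_lift[OF q_columnsD(3)[OF YZ ij]] add_ac)
qed

lemma q_columns_scale_right:
  "q_columns X Y \<Longrightarrow> (\<And>i. p * X i = X i * p) \<Longrightarrow> q_columns X (\<lambda>i. Y i * p)"
  using q_columns_comb_right[of X Y Y p 0] by simp

lemma q_columns_scale_left:
  "q_columns X Z \<Longrightarrow> (\<And>i. p * Z i = Z i * p) \<Longrightarrow> q_columns (\<lambda>i. X i * p) Z"
  using q_columns_comb_left[of X Z X p 0] by simp

text \<open>The mixed terms agree because \<open>1 + q^(1/2) (q^(1/2) - q^(-1/2)) = q\<close>: the
  correction in the diagonal relation is absorbed by the q-commutation of \<open>p\<close> and
  \<open>p'\<close>.\<close>

lemma q_column_comb:
  assumes X: "q_column X" and Y: "q_column Y" and XY: "q_columns X Y"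
    and p: "\<And>i. p * X i = X i * p" "\<And>i. p * Y i = Y i * p"
    and p': "\<And>i. p' * X i = X i * p'" "\<And>i. p' * Y i = Y i * p'"
    and pp': "p' * p = qpow 1 * (p * p')"
  shows "q_column (\<lambda>i. X i * p + Y i * p')"
  unfolding q_column_def
proof (intro allI impI)
  fix i j :: nat assume ij: "i < j"
  note rules = distrib_left distrib_right mult.assoc qpow_left_comm[of "X _"] qpow_left_comm[of "Y _"]
    qpow_left_comm[of p] qpow_left_comm[of p'] mult_assoc_lift[OF p(1)] mult_assoc_lift[OF p(2)] mult_assoc_lift[OF p'(1)]
    mult_assoc_lift[OF p'(2)] pp'
  show "(X j * p + Y j * p') * (X i * p + Y i * p') = qpow 1 * ((X i * p + Y i * p') * (X j * p + Y j * p'))"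
    by (simp add: rules mult_assoc_lift[OF q_columnD[OF X ij]] mult_assoc_lift[OF q_columnD[OF Y ij]]
        mult_assoc_lift[OF q_columnsD(2)[OF XY ij]] mult_assoc_lift[OF q_columnsD(3)[OF XY ij]] q_delta_qpow)
qed

lemma q_column_scale:
  assumes X: "q_column X" and p: "\<And>i. p * X i = X i * p"
  shows "q_column (\<lambda>i. X i * p)"
  unfolding q_column_def
  by (simp add: q_expand mult_assoc_lift[OF p] mult_assoc_lift[OF q_columnD[OF X]])

text \<open>Both columns are multiples of \<open>X\<close>, so each product reduces to
  \<open>X i * X j * (r * t)\<close> times a power of \<open>q^(1/2)\<close>. The diagonal relation
  then becomes the identity \<open>q = 1 + (q^(1/2) - q^(-1/2)) q^(1/2)\<close>.\<close>

lemma q_columns_split: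
  assumes X: "q_column X" and r: "\<And>i. r * X i = X i * r" and t: "\<And>i. t * X i = X i * t"
    and tr: "t * r = qpow 1 * (r * t)"
  shows "q_columns (\<lambda>i. X i * r) (\<lambda>i. X i * t)"
  unfolding q_columns_def
proof (intro conjI allI impI)
  fix i j :: nat
  note rules = mult.assoc qpow_left_comm[of "X _"] mult_assoc_lift[OF r] mult_assoc_lift[OF t] tr
  show "X i * t * (X i * r) = qpow 1 * (X i * r * (X i * t))"
    by (simp add: rules)
  assume ij: "i < j"
  show "X j * r * (X i * t) = X i * t * (X j * r)"
    by (simp add: rules mult_assoc_lift[OF q_columnD[OF X ij]])
  show "X j * t * (X i * r) = X i * r * (X j * t) + q_delta * (X i * t * (X j * r))"
    by (simp add: rules mult_assoc_lift[OF q_columnD[OF X ij]] q_delta_qpow)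
qed


section \<open>The path matrix\<close>

text \<open>The path weights in the torus after the first \<open>k\<close> crossings. The local
  \<open>C\<close> is the weight of all paths from \<open>i\<close> to the new central
  vertex.\<close>

fun path_mat :: "nat list \<Rightarrow> nat \<Rightarrow> nat \<Rightarrow> nat \<Rightarrow> qtorus" where
  "path_mat ss 0 i j = (if i = j then 1 else 0)"
| "path_mat ss (Suc k) i j =
     (let s = crossing ss (Suc k);
          C = path_mat ss k i s * zvar (s, Suc k, 1) + path_mat ss k i (Suc s) * zvar (Suc s, Suc k, 1)
      in if j = s then C * zvar (s, Suc k, 2)
         else if j = Suc s then C * zvar (Suc s, Suc k, 2)
         else path_mat ss k i j)"

text \<open>Up to stage \<open>k\<close> only variables of the first \<open>k\<close> crossings
  occur, hence a new crossing multiplies by coefficients that commute with everything before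
  it.\<close>

lemma zvar_path_mat_comm:
  "k < j \<Longrightarrow> zvar (h, j, c) * path_mat ss k i l = path_mat ss k i l * zvar (h, j, c)"
proof (induction k arbitrary: l)
  case (Suc k)
  note comm = Suc.IH[OF Suc_lessD[OF Suc.prems]]
  have z: "zvar (h, j, c) * zvar (h', Suc k, c') = zvar (h', Suc k, c') * zvar (h, j, c)" for h' c'
    using Suc.prems by (intro zvar_comm) simp
  show ?case
    by (auto simp: Let_def distrib_left distrib_right mult.assoc z mult_assoc_lift[OF comm]
        mult_assoc_lift[OF z] comm)
qed simp

lemma q_columns_path_mat:
  "q_column (\<lambda>i. path_mat ss k i l)"
  "l < l' \<Longrightarrow> q_columns (\<lambda>i. path_mat ss k i l) (\<lambda>i. path_mat ss k i l')"
proof (induction k arbitrary: l l')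
  case 0
  show "q_column (\<lambda>i. path_mat ss 0 i l)" for l
    by (auto simp: q_column_def)
  show "q_columns (\<lambda>i. path_mat ss 0 i l) (\<lambda>i. path_mat ss 0 i l')" if "l < l'" for l l'
    using that by (auto simp: q_columns_def)
next
  case (Suc k)
  define s where "s = crossing ss (Suc k)"
  define B where "B = (\<lambda>l i. path_mat ss k i l)"
  define p where "p = zvar (s, Suc k, 1)"
  define p' where "p' = zvar (Suc s, Suc k, 1)"
  define r where "r = zvar (s, Suc k, 2)"
  define r' where "r' = zvar (Suc s, Suc k, 2)"
  define C where "C = (\<lambda>i. B s i * p + B (Suc s) i * p')"
  have step: "(\<lambda>i. path_mat ss (Suc k) i l) =
      (if l = s then (\<lambda>i. C i * r) else if l = Suc s then (\<lambda>i. C i * r') else B l)" for l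
    by (auto simp: s_def B_def p_def p'_def r_def r'_def C_def Let_def)
  have col: "q_column (B l)" and cols: "l < l' \<Longrightarrow> q_columns (B l) (B l')" for l l'
    unfolding B_def using Suc.IH by simp_all
  have comm: "p * B l i = B l i * p" "p' * B l i = B l i * p'" "r * B l i = B l i * r" "r' * B l i = B l i * r'" for l i
    unfolding B_def p_def p'_def r_def r'_def by (simp_all add: zvar_path_mat_comm)
  have zcomm: "r * p = p * r" "r' * p = p * r'" "r * p' = p' * r" "r' * p' = p' * r'"
    unfolding p_def p'_def r_def r'_def by (rule zvar_comm, simp)+
  have pp': "p' * p = qpow 1 * (p * p')" and rr': "r' * r = qpow 1 * (r * r')"
    unfolding p_def p'_def r_def r'_def by (simp_all add: zvar_q_comm mult.assoc)
  have commC: "r * C i = C i * r" "r' * C i = C i * r'" for i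
    unfolding C_def by (simp_all add: distrib_left distrib_right mult.assoc zcomm
        mult_assoc_lift[OF comm(3)] mult_assoc_lift[OF comm(4)])
  have C: "q_column C"
    unfolding C_def using q_column_comb[OF col col cols[OF lessI] _ _ _ _ pp'] comm by blast
  have CR: "q_columns C (B l)" if "Suc s < l" for l
    unfolding C_def using q_columns_comb_left[OF cols cols] that comm by simp
  have CL: "q_columns (B l) C" if "l < s" for l
    unfolding C_def using q_columns_comb_right[OF cols cols] that comm by simp
  have Crr': "q_columns (\<lambda>i. C i * r) (\<lambda>i. C i * r')"
    by (rule q_columns_split[OF C commC rr'])
  show "q_column (\<lambda>i. path_mat ss (Suc k) i l)" for l
    unfolding step using col q_column_scale[OF C] commC by simp
  show "q_columns (\<lambda>i. path_mat ss (Suc k) i l) (\<lambda>i. path_mat ss (Suc k) i l')" if "l < l'" for l l'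
  proof -
    \<comment> \<open>The levels \<open>s\<close> and \<open>Suc s\<close> are adjacent, so any
      other column lies on the same side of both.\<close>
    have "l \<notin> {s, Suc s} \<and> l' \<notin> {s, Suc s} \<or> l = s \<and> l' = Suc s \<or> l \<in> {s, Suc s} \<and> Suc s < l'
      \<or> l < s \<and> l' \<in> {s, Suc s}"
      using that by auto
    then consider "l \<notin> {s, Suc s}" "l' \<notin> {s, Suc s}" | "l = s" "l' = Suc s" | "l \<in> {s, Suc s}" "Suc s < l'"
      | "l < s" "l' \<in> {s, Suc s}"
      by blast
    then show ?thesis
    proof cases
      case 1
      then show ?thesis unfolding step using cols[OF that] by simp
    next
      case 2
      then show ?thesis unfolding step using Crr' by simp
    next
      case 3
      then show ?thesis
        unfolding step using q_columns_scale_left[OF CR[OF 3(2)]] comm by auto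
    next
      case 4
      then show ?thesis
        unfolding step using q_columns_scale_right[OF CL[OF 4(1)]] comm by auto
    qed
  qed
qed


section \<open>Paths in the wiring diagram\<close>

text \<open>Twice the horizontal position, up to a shift at the centers: the center of a crossing
  lies strictly between the junctions before and after it.\<close>

fun wire_rank :: "wire_vertex \<Rightarrow> nat" where
  "wire_rank (Junction h j) = 2 * j"
| "wire_rank (Center j) = 2 * j - 1"

lemma cas_snoc:
  "pre_digraph.cas G u (p @ [e]) v \<longleftrightarrow> pre_digraph.cas G u p (tail G e) \<and> head G e = v"
  by (induction p arbitrary: u) (auto simp: pre_digraph.cas.simps)

lemma awalk_snoc:
  "pre_digraph.awalk G u (p @ [e]) v \<longleftrightarrow>
     pre_digraph.awalk G u p (tail G e) \<and> e \<in> arcs G \<and> head G e = v"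
  by (auto simp: pre_digraph.awalk_def cas_snoc)

lemma awalk_snoc2:
  "pre_digraph.awalk G u (p @ [d, e]) v \<longleftrightarrow>
     pre_digraph.awalk G u p (tail G d) \<and> d \<in> arcs G \<and> head G d = tail G e \<and> e \<in> arcs G \<and> head G e = v"
  using awalk_snoc[of G u "p @ [d]" e v] by (auto simp: awalk_snoc)

context wiring
begin

abbreviation "G \<equiv> wiring_diagram n ss"

lemma diagram_simps [simp]: "tail G = wire_tail" "head G = wire_head"
  by (simp_all add: wiring_diagram_def)

lemma arcs_iff:
  "Straight h j \<in> arcs G \<longleftrightarrow> j \<in> {1..length ss} \<and> h \<in> {1..n} - crossing_levels ss j"
  "Enter h j \<in> arcs G \<longleftrightarrow> j \<in> {1..length ss} \<and> h \<in> crossing_levels ss j"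
  "Leave h j \<in> arcs G \<longleftrightarrow> j \<in> {1..length ss} \<and> h \<in> crossing_levels ss j"
  by (auto simp: wiring_diagram_def)

lemma arc_rank: "e \<in> arcs G \<Longrightarrow> wire_rank (wire_tail e) < wire_rank (wire_head e)"
  by (cases e) (auto simp: arcs_iff)

text \<open>Every arc raises the rank, so no walk can meet a vertex twice.\<close>

lemma apath_iff_awalk: "pre_digraph.apath G u p v \<longleftrightarrow> pre_digraph.awalk G u p v"
proof -
  have "distinct (pre_digraph.awalk_verts G u p) \<and>
      (\<forall>x \<in> set (pre_digraph.awalk_verts G u p). wire_rank u \<le> wire_rank x)"
    if "set p \<subseteq> arcs G" "pre_digraph.cas G u p v"
    using that
  proof (induction p arbitrary: u)
    case (Cons e p)
    then have "wire_tail e = u" "wire_rank u < wire_rank (wire_head e)"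
      using arc_rank[of e] by (auto simp: pre_digraph.cas.simps)
    moreover have "distinct (pre_digraph.awalk_verts G (wire_head e) p) \<and>
      (\<forall>x \<in> set (pre_digraph.awalk_verts G (wire_head e) p). wire_rank (wire_head e) \<le> wire_rank x)"
      using Cons.IH[of "wire_head e"] Cons.prems by (simp add: pre_digraph.cas.simps)
    ultimately show ?case
      by (fastforce simp: pre_digraph.awalk_verts.simps)
  qed (simp add: pre_digraph.awalk_verts.simps)
  then show ?thesis
    unfolding pre_digraph.apath_def pre_digraph.awalk_def by blast
qed

section \<open>Walks decomposed by their last elementary diagram\<close>

definition walks :: "nat \<Rightarrow> nat \<Rightarrow> nat \<Rightarrow> wire_arc list set" where
  "walks i k j = {p. pre_digraph.awalk G (Junction i 0) p (Junction j k)}"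

lemma walks_0: "i \<in> {1..n} \<Longrightarrow> walks i 0 j = (if i = j then {[]} else {})"
proof -
  assume i: "i \<in> {1..n}"
  have "p \<in> walks i 0 j \<longleftrightarrow> p = [] \<and> i = j" for p
  proof (cases p rule: rev_cases)
    case Nil
    then show ?thesis
      using i by (auto simp: walks_def pre_digraph.awalk_def pre_digraph.cas.simps wiring_diagram_def)
  next
    case (snoc p' e)
    then show ?thesis
      by (cases e) (auto simp: walks_def awalk_snoc arcs_iff)
  qed
  then show ?thesis by auto
qed

lemma walks_Suc_straight:
  assumes "k < length ss" "j \<in> {1..n}" "j \<notin> crossing_levels ss (Suc k)"
  shows "walks i (Suc k) j = (\<lambda>p. p @ [Straight j (Suc k)]) ` walks i k j"
proof -
  have "p \<in> walks i (Suc k) j \<longleftrightarrow> p \<in> (\<lambda>p. p @ [Straight j (Suc k)]) ` walks i k j" for p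
  proof (cases p rule: rev_cases)
    case Nil
    then show ?thesis
      by (auto simp: walks_def pre_digraph.awalk_def pre_digraph.cas.simps)
  next
    case (snoc p' e)
    then show ?thesis
      using assms by (cases e) (auto simp: walks_def awalk_snoc arcs_iff)
  qed
  then show ?thesis by blast
qed

text \<open>A junction on a crossing level is reached only from the center, and the center only by
  an entering arc, so the last two arcs are determined by the level of entry.\<close>

lemma walks_Suc_crossing:
  assumes "k < length ss" "j \<in> crossing_levels ss (Suc k)"
  shows "walks i (Suc k) j =
    (\<Union>h\<in>crossing_levels ss (Suc k). (\<lambda>p. p @ [Enter h (Suc k), Leave j (Suc k)]) ` walks i k h)"
    (is "_ = ?R")
proof -
  have "p \<in> walks i (Suc k) j \<longleftrightarrow> p \<in> ?R" for p
  proof (cases p rule: rev_cases)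
    case Nil
    then show ?thesis
      by (auto simp: walks_def pre_digraph.awalk_def pre_digraph.cas.simps)
  next
    case p: (snoc p' e)
    show ?thesis
    proof (cases p' rule: rev_cases)
      case Nil
      then show ?thesis
        using p assms
        by (cases e) (auto simp: walks_def pre_digraph.awalk_def pre_digraph.cas.simps arcs_iff)
    next
      case (snoc p'' d)
      then show ?thesis
        using p assms
        by (cases e; cases d)
          (auto simp: walks_def awalk_snoc awalk_snoc2 arcs_iff image_iff)
    qed
  qed
  then show ?thesis by blast
qed


fun torus_weight :: "wire_arc \<Rightarrow> qtorus" where
  "torus_weight (Straight h j) = 1"
| "torus_weight (Enter h j) = zvar (h, j, 1)"
| "torus_weight (Leave h j) = zvar (h, j, 2)"

lemma walks_weight:
  assumes "i \<in> {1..n}" "k \<le> length ss" "j \<in> {1..n}"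
  shows "finite (walks i k j) \<and> (\<Sum>p\<in>walks i k j. prod_list (map torus_weight p)) = path_mat ss k i j"
  using assms(2,3)
proof (induction k arbitrary: j)
  case 0
  then show ?case using assms(1) by (simp add: walks_0)
next
  case (Suc k)
  define s where "s = crossing ss (Suc k)"
  have s: "s \<in> {1..n}" "Suc s \<in> {1..n}"
    using crossing_bounds[of "Suc k"] Suc.prems by (auto simp: s_def)
  have levels: "crossing_levels ss (Suc k) = {s, Suc s}"
    by (simp add: crossing_levels_def s_def)
  have IH: "finite (walks i k h)" "(\<Sum>p\<in>walks i k h. prod_list (map torus_weight p)) = path_mat ss k i h"
    if "h \<in> {1..n}" for h
    using Suc.IH[of h] Suc.prems that by auto
  show ?case
  proof (cases "j \<in> {s, Suc s}")
    case False
    have "inj_on (\<lambda>p. p @ [Straight j (Suc k)]) (walks i k j)"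
      by (simp add: inj_on_def)
    with False Suc.prems IH[of j] show ?thesis
      by (simp add: walks_Suc_straight levels sum.reindex s_def[symmetric])
  next
    case True
    let ?f = "\<lambda>h p. p @ [Enter h (Suc k), Leave j (Suc k)]"
    have inj: "inj_on (?f h) (walks i k h)" for h
      by (simp add: inj_on_def)
    have eq: "walks i (Suc k) j = ?f s ` walks i k s \<union> ?f (Suc s) ` walks i k (Suc s)"
      using walks_Suc_crossing[of k j i] Suc.prems True by (simp add: levels)
    have "(\<Sum>p\<in>walks i (Suc k) j. prod_list (map torus_weight p)) =
        (\<Sum>p\<in>?f s ` walks i k s. prod_list (map torus_weight p)) +
        (\<Sum>p\<in>?f (Suc s) ` walks i k (Suc s). prod_list (map torus_weight p))"
      unfolding eq using IH s by (intro sum.union_disjoint) auto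
    also have "\<dots> = path_mat ss k i s * (zvar (s, Suc k, 1) * zvar (j, Suc k, 2))
        + path_mat ss k i (Suc s) * (zvar (Suc s, Suc k, 1) * zvar (j, Suc k, 2))"
      by (simp add: sum.reindex[OF inj] flip: sum_distrib_right)
        (simp add: IH(2)[OF s(1)] IH(2)[OF s(2)])
    also have "\<dots> = path_mat ss (Suc k) i j"
      using True by (auto simp: Let_def s_def[symmetric] distrib_right mult.assoc)
    finally show ?thesis using eq IH s by simp
  qed
qed

section \<open>Representatives of the path weights in the free algebra\<close>

fun free_weight :: "wire_arc \<Rightarrow> (nat \<times> nat \<times> nat) freealg" where
  "free_weight (Straight h j) = 1"
| "free_weight (Enter h j) = fvar (h, j, 1)"
| "free_weight (Leave h j) = fvar (h, j, 2)"

lemma free_weight_closed: "e \<in> arcs G \<Longrightarrow> free_weight e \<in> carrier F"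
  by (cases e)
    (auto intro!: free_closed crossing_vars simp: arcs_iff crossing_levels_def)

definition free_path_mat :: "nat \<Rightarrow> nat \<Rightarrow> (nat \<times> nat \<times> nat) freealg" where
  "free_path_mat i j = (\<Sum>p\<in>walks i (length ss) j. prod_list (map free_weight p))"

lemma walk_weight_closed: "p \<in> walks i k j \<Longrightarrow> prod_list (map free_weight p) \<in> carrier F"
  by (auto intro!: free_algebra_prod_list_closed free_weight_closed simp: walks_def pre_digraph.awalk_def)

lemma free_path_mat_closed: "free_path_mat i j \<in> carrier F"
  unfolding free_path_mat_def by (intro free_algebra_sum_closed walk_weight_closed)

lemma path_matrix_cls:
  assumes "i \<in> {1..n}" "j \<in> {1..n}"
  shows "path_matrix n ss i j = cls (free_path_mat i j)"
proof -
  have "arc_weight n ss e = cls (free_weight e)" for e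
    by (cases e) (simp_all add: wire_z wire_algebra cls_one)
  then have weight: "arc_weight n ss = (\<lambda>e. cls (free_weight e))" by blast
  have "list_prod A (map (arc_weight n ss) p) = cls (prod_list (map free_weight p))"
    if "p \<in> walks i (length ss) j" for p
    unfolding weight using that
    by (intro cls_prod_list free_weight_closed) (auto simp: walks_def pre_digraph.awalk_def)
  then have "(\<Oplus>\<^bsub>A\<^esub>p\<in>walks i (length ss) j. list_prod A (map (arc_weight n ss) p))
      = (\<Oplus>\<^bsub>A\<^esub>p\<in>walks i (length ss) j. cls (prod_list (map free_weight p)))"
    by (intro A.finsum_cong') (auto intro: cls_closed walk_weight_closed)
  then show ?thesis
    using walks_weight[OF assms(1) order.refl assms(2)]
    by (simp add: path_matrix_def wire_algebra apath_iff_awalk free_path_mat_def cls_finsum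
        walk_weight_closed flip: walks_def)
qed

lemma torus_eval_free_path_mat:
  assumes "i \<in> {1..n}" "j \<in> {1..n}"
  shows "torus_eval zvar (free_path_mat i j) = path_mat ss (length ss) i j"
proof -
  have "torus_eval zvar (free_weight e) = torus_weight e" for e
    by (cases e) (simp_all add: torus_eval_simps)
  then show ?thesis
    using walks_weight[OF assms(1) order.refl assms(2)]
    by (simp add: free_path_mat_def torus_eval_simps comp_def)
qed

lemma zG_coeff_path_product:
  assumes "v permutes {1..n}"
  shows "zG_coeff n ss (list_prod (wire_algebra n ss) (map (\<lambda>i. path_matrix n ss i (v i)) [1..<Suc n]))
    = zcoeff (mset (wire_vars n ss)) (prod_list (map (\<lambda>i. path_mat ss (length ss) i (v i)) [1..<Suc n]))"
proof -
  have v: "v i \<in> {1..n}" if "i \<in> {1..n}" for i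
    using permutes_in_image[OF assms] that by blast
  have range: "set [1..<Suc n] = {1..n}" by auto
  have eq1: "map (\<lambda>i. path_matrix n ss i (v i)) [1..<Suc n] = map (\<lambda>i. cls (free_path_mat i (v i))) [1..<Suc n]"
    by (intro map_cong refl path_matrix_cls v) (simp_all only: range)
  have eq2: "map (\<lambda>i. torus_eval zvar (free_path_mat i (v i))) [1..<Suc n]
      = map (\<lambda>i. path_mat ss (length ss) i (v i)) [1..<Suc n]"
    by (intro map_cong refl torus_eval_free_path_mat v) (simp_all only: range)
  let ?P = "prod_list (map (\<lambda>i. free_path_mat i (v i)) [1..<Suc n])"
  have "?P \<in> carrier F"
    by (intro free_algebra_prod_list_closed) (auto simp: free_path_mat_closed simp del: upt_Suc)
  then have "zG_coeff n ss (cls ?P) = zcoeff (mset (wire_vars n ss)) (torus_eval zvar ?P)"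
    by (rule zG_coeff_cls)
  moreover have "list_prod A (map (\<lambda>i. cls (free_path_mat i (v i))) [1..<Suc n]) = cls ?P"
    by (rule cls_prod_list) (rule free_path_mat_closed)
  ultimately show ?thesis
    by (simp only: eq1 wire_algebra torus_eval_simps map_map comp_def eq2)
qed

end


section \<open>Existence of the evaluation map on the quantum matrix bialgebra\<close>

definition entries :: "nat \<Rightarrow> (nat \<times> nat) set" where
  "entries n = {1..n} \<times> {1..n}"

lemma qmat_rels_closed: "qmat_rels n \<subseteq> carrier (free_algebra (entries n))"
  unfolding qmat_rels_def entries_def by (auto intro!: free_closed)

context wiring
begin

sublocale M: presentation "entries n" "qmat_rels n"
  by standard (rule qmat_rels_closed)

lemma qmat_algebra: "qmat n = M.A"
  by (simp add: qmat_def entries_def)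

lemma qmat_x: "qmat_x n i j = M.cls (xvar i j)"
  unfolding qmat_x_def entries_def[symmetric] by (rule M.presented_gen_cls)

definition mat_eval :: "(nat \<times> nat) freealg \<Rightarrow> qtorus" where
  "mat_eval = torus_eval (\<lambda>(i, j). path_mat ss (length ss) i j)"

lemma mat_eval_rel:
  assumes "r \<in> qmat_rels n"
  shows "mat_eval r = 0"
proof -
  define B where "B = path_mat ss (length ss)"
  note cols = q_columns_path_mat(2)[of _ _ ss "length ss", folded B_def]
  consider (row) i k l where "r = xvar i l * xvar i k - fscalar (qhalf 1) * xvar i k * xvar i l" "k < l"
    | (anti) i j k l where "r = xvar j k * xvar i l - xvar i l * xvar j k" "i < j" "k < l"
    | (col) i j k where "r = xvar j k * xvar i k - fscalar (qhalf 1) * xvar i k * xvar j k" "i < j"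
    | (diag) i j k l where "r = xvar j l * xvar i k
        - (xvar i k * xvar j l + fscalar (qhalf 1 - qhalf (-1)) * xvar i l * xvar j k)" "i < j" "k < l"
    using assms unfolding qmat_rels_def by blast
  then show ?thesis
  proof cases
    case row
    then show ?thesis
      using q_columnsD(1)[OF cols[OF row(2)], of i]
      by (simp add: mat_eval_def torus_eval_simps qscalar_qhalf mult.assoc B_def)
  next
    case anti
    then show ?thesis
      using q_columnsD(2)[OF cols[OF anti(3)] anti(2)]
      by (simp add: mat_eval_def torus_eval_simps B_def)
  next
    case col
    then show ?thesis
      using q_columnD[OF q_columns_path_mat(1)[of ss "length ss" k] col(2)]
      by (simp add: mat_eval_def torus_eval_simps qscalar_qhalf mult.assoc)
  next
    case diag
    have "qscalar (qhalf 1 - qhalf (-1)) = q_delta"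
      by (simp add: q_delta_def qscalar_def qscalar_hom.eval_diff flip: qscalar_qhalf)
    then show ?thesis
      using q_columnsD(3)[OF cols[OF diag(3)] diag(2)]
      by (simp add: diag(1) mat_eval_def torus_eval_simps mult.assoc B_def)
  qed
qed

lemma mat_eval_cong: "M.rel_cong p p' \<Longrightarrow> mat_eval p = mat_eval p'"
  using M.hom_vanishes_on_ideal[of mat_eval "p - p'"] mat_eval_rel
  by (simp add: mat_eval_def torus_eval_simps M.rel_cong_def)

text \<open>The representative is chosen arbitrarily; \<open>mat_eval\<close> kills the relations
  and is therefore constant on cosets.\<close>

definition mat_functional :: "(nat \<times> nat) freealg set \<Rightarrow> laurent" where
  "mat_functional a = zcoeff (mset (wire_vars n ss)) (mat_eval (SOME p. p \<in> carrier M.F \<and> a = M.cls p))"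

lemma mat_functional_cls:
  assumes "p \<in> carrier M.F"
  shows "mat_functional (M.cls p) = zcoeff (mset (wire_vars n ss)) (mat_eval p)"
proof -
  define p' where "p' = (SOME p'. p' \<in> carrier M.F \<and> M.cls p = M.cls p')"
  have "p' \<in> carrier M.F \<and> M.cls p = M.cls p'"
    unfolding p'_def by (rule someI[of _ p]) (simp add: assms)
  then have "mat_eval p = mat_eval p'"
    using assms M.cls_eq_iff mat_eval_cong by blast
  then show ?thesis by (simp add: mat_functional_def p'_def)
qed

lemma mat_functional_linear: "linear_on (qmat n) (carrier (qmat n)) mat_functional"
  unfolding linear_on_def qmat_algebra M.carrier_cls
  by (auto simp: M.cls_add M.cls_smult mat_functional_cls free_closed)
    (simp_all add: mat_eval_def torus_eval_simps zcoeff_add zcoeff_qscalar)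

definition free_monom :: "(nat \<Rightarrow> nat) \<Rightarrow> (nat \<Rightarrow> nat) \<Rightarrow> (nat \<times> nat) freealg" where
  "free_monom u v = prod_list (map (\<lambda>k. xvar (u k) (v k)) [1..<Suc n])"

lemma qmat_monom_cls:
  assumes "u permutes {1..n}" "v permutes {1..n}"
  shows "qmat_monom n u v = M.cls (free_monom u v)" "free_monom u v \<in> carrier M.F"
proof -
  have c: "xvar (u k) (v k) \<in> carrier M.F" if "k \<in> set [1..<Suc n]" for k
    using permutes_in_image[OF assms(1), of k] permutes_in_image[OF assms(2), of k] that
    by (auto intro!: free_closed simp: entries_def)
  show "qmat_monom n u v = M.cls (free_monom u v)"
    using M.cls_prod_list[of "[1..<Suc n]" "\<lambda>k. xvar (u k) (v k)"] c
    by (simp add: qmat_monom_def qmat_algebra qmat_x free_monom_def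
        del: upt_Suc One_nat_def)
  show "free_monom u v \<in> carrier M.F"
    unfolding free_monom_def using c by (intro free_algebra_prod_list_closed) (auto simp del: upt_Suc)
qed

lemma immanant_space_subset: "immanant_space n \<subseteq> carrier (qmat n)"
proof -
  have "(\<Oplus>\<^bsub>M.A\<^esub>b\<in>S. c b \<odot>\<^bsub>M.A\<^esub> b) \<in> carrier M.A"
    if "S \<subseteq> {qmat_monom n u v | u v. u permutes {1..n} \<and> v permutes {1..n}}" for S c
  proof (rule M.A.finsum_closed, rule Pi_I)
    fix b assume "b \<in> S"
    then have "\<exists>u v. b = qmat_monom n u v \<and> u permutes {1..n} \<and> v permutes {1..n}"
      using that by blast
    then show "c b \<odot>\<^bsub>M.A\<^esub> b \<in> carrier M.A"
      by (auto simp: qmat_monom_cls M.cls_smult intro!: M.cls_closed free_closed)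
  qed
  then show ?thesis
    unfolding immanant_space_def linear_span_def qmat_algebra by blast
qed

abbreviation torus_coeff :: "(nat \<Rightarrow> nat) \<Rightarrow> laurent" where
  "torus_coeff v \<equiv> zcoeff (mset (wire_vars n ss))
     (prod_list (map (\<lambda>i. path_mat ss (length ss) i (v i)) [1..<Suc n]))"

text \<open>Since \<open>sigma\<close> is an arbitrary choice, these are the only facts used about
  it; \<open>mat_functional\<close> witnesses that some map satisfies them.\<close>

lemma sigma_properties:
  "linear_on (qmat n) (immanant_space n) (sigma n ss)"
  "v permutes {1..n} \<Longrightarrow> sigma n ss (qmat_monom n id v) = torus_coeff v"
proof -
  have "\<exists>\<sigma>. linear_on (qmat n) (immanant_space n) \<sigma> \<and>
        (\<forall>v. v permutes {1..n} \<longrightarrow>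
           \<sigma> (qmat_monom n id v) =
             zG_coeff n ss
               (list_prod (wire_algebra n ss)
                  (map (\<lambda>i. path_matrix n ss i (v i)) [1..<Suc n])))"
  proof (intro exI conjI allI impI)
    show "linear_on (qmat n) (immanant_space n) mat_functional"
      using mat_functional_linear immanant_space_subset unfolding linear_on_def by blast
    fix v assume v: "v permutes {1..n}"
    show "mat_functional (qmat_monom n id v) = zG_coeff n ss
               (list_prod (wire_algebra n ss) (map (\<lambda>i. path_matrix n ss i (v i)) [1..<Suc n]))"
      using v qmat_monom_cls[OF permutes_id v]
      by (simp add: mat_functional_cls zG_coeff_path_product mat_eval_def free_monom_def
          torus_eval_simps comp_def del: upt_Suc One_nat_def)
  qed
  from someI_ex[OF this] have
    "linear_on (qmat n) (immanant_space n) (sigma n ss) \<and>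
        (\<forall>v. v permutes {1..n} \<longrightarrow>
           sigma n ss (qmat_monom n id v) =
             zG_coeff n ss
               (list_prod (wire_algebra n ss)
                  (map (\<lambda>i. path_matrix n ss i (v i)) [1..<Suc n])))"
    unfolding sigma_def .
  then show "linear_on (qmat n) (immanant_space n) (sigma n ss)"
    "v permutes {1..n} \<Longrightarrow> sigma n ss (qmat_monom n id v) = torus_coeff v"
    using zG_coeff_path_product by auto
qed

text \<open>Linearity of \<open>sigma\<close> is known only on the immanant space, so membership of
  the partial sums is carried through the induction.\<close>

lemma sigma_sum:
  assumes "finite S" "\<And>v. v \<in> S \<Longrightarrow> v permutes {1..n}"
  shows "(\<Oplus>\<^bsub>qmat n\<^esub>v\<in>S. c v \<odot>\<^bsub>qmat n\<^esub> qmat_monom n id v) \<in> immanant_space n \<and>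
    sigma n ss (\<Oplus>\<^bsub>qmat n\<^esub>v\<in>S. c v \<odot>\<^bsub>qmat n\<^esub> qmat_monom n id v) = (\<Sum>v\<in>S. c v * torus_coeff v)"
  using assms
proof induction
  case empty
  have "\<zero>\<^bsub>qmat n\<^esub> \<in> immanant_space n"
    unfolding immanant_space_def qmat_algebra by (rule M.zero_in_span)
  moreover have "sigma n ss \<zero>\<^bsub>qmat n\<^esub> = 0"
  proof -
    have "\<zero>\<^bsub>qmat n\<^esub> \<oplus>\<^bsub>qmat n\<^esub> \<zero>\<^bsub>qmat n\<^esub> = \<zero>\<^bsub>qmat n\<^esub>"
      by (simp add: qmat_algebra)
    then show ?thesis
      using sigma_properties(1) \<open>\<zero>\<^bsub>qmat n\<^esub> \<in> immanant_space n\<close>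
      unfolding linear_on_def by (metis add_cancel_right_right)
  qed
  ultimately show ?case by (simp add: qmat_algebra)
next
  case (insert v S)
  define M where "M = {qmat_monom n u v | u v. u permutes {1..n} \<and> v permutes {1..n}}"
  define x where "x = (\<Oplus>\<^bsub>qmat n\<^esub>v\<in>S. c v \<odot>\<^bsub>qmat n\<^esub> qmat_monom n id v)"
  have M: "M \<subseteq> carrier M.A"
    by (auto simp: M_def qmat_monom_cls M.cls_closed)
  have vM: "qmat_monom n id v \<in> M"
    unfolding M_def using insert.prems permutes_id by blast
  have "w permutes {1..n}" if "w \<in> S" for w
    using insert.prems that by blast
  note IH = conjunct1[OF insert.IH[OF this], folded x_def] conjunct2[OF insert.IH[OF this], folded x_def]
  have mono: "qmat_monom n id v \<in> immanant_space n" "c v \<odot>\<^bsub>qmat n\<^esub> qmat_monom n id v \<in> immanant_space n"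
    using M.smult_in_span[OF M vM] M.base_in_span[OF M vM]
    by (simp_all add: immanant_space_def M_def qmat_algebra)
  have "(\<lambda>v. c v \<odot>\<^bsub>qmat n\<^esub> qmat_monom n id v) \<in> insert v S \<rightarrow> carrier (qmat n)"
    using insert.prems permutes_id
    by (auto simp: qmat_algebra qmat_monom_cls M.cls_smult intro!: M.cls_closed free_closed)
  then have eq: "(\<Oplus>\<^bsub>qmat n\<^esub>v\<in>insert v S. c v \<odot>\<^bsub>qmat n\<^esub> qmat_monom n id v)
      = c v \<odot>\<^bsub>qmat n\<^esub> qmat_monom n id v \<oplus>\<^bsub>qmat n\<^esub> x"
    unfolding qmat_algebra x_def using insert.hyps by (subst M.A.finsum_insert) auto
  have "c v \<odot>\<^bsub>qmat n\<^esub> qmat_monom n id v \<oplus>\<^bsub>qmat n\<^esub> x \<in> immanant_space n"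
    using M.span_add_smult[OF M _ vM] IH(1) unfolding immanant_space_def M_def[symmetric] qmat_algebra .
  moreover have "sigma n ss (c v \<odot>\<^bsub>qmat n\<^esub> qmat_monom n id v \<oplus>\<^bsub>qmat n\<^esub> x)
      = c v * torus_coeff v + (\<Sum>v\<in>S. c v * torus_coeff v)"
  proof -
    have "sigma n ss (c v \<odot>\<^bsub>qmat n\<^esub> qmat_monom n id v \<oplus>\<^bsub>qmat n\<^esub> x)
        = sigma n ss (c v \<odot>\<^bsub>qmat n\<^esub> qmat_monom n id v) + sigma n ss x"
      using sigma_properties(1) mono(2) IH(1) unfolding linear_on_def by blast
    also have "sigma n ss (c v \<odot>\<^bsub>qmat n\<^esub> qmat_monom n id v) = c v * sigma n ss (qmat_monom n id v)"
      using sigma_properties(1) mono(1) unfolding linear_on_def by blast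
    finally show ?thesis
      by (simp only: IH(2) sigma_properties(2)[OF insert.prems[OF insertI1]])
  qed
  ultimately show ?case
    unfolding eq sum.insert[OF insert.hyps] by blast
qed

end


section \<open>Recursion for the coefficients\<close>

text \<open>Here \<open>x\<close>, \<open>y\<close> are the entering variables of a crossing,
  \<open>r\<close>, \<open>w\<close> the leaving ones, and \<open>a1\<close>, \<open>a2\<close>,
  \<open>b1\<close>, \<open>b2\<close> the entries of the two rows that meet. The new variables are
  collected on the right, with the order inside the entering pair and inside the leaving pair kept,
  because these orders carry the power of \<open>q\<close>.\<close>

lemma crossing_product_expand:
  fixes x y r w :: "'a::ring_1"
  assumes "x * P2 = P2 * x" "y * P2 = P2 * y" "r * P2 = P2 * r"
    and "x * P3 = P3 * x" "y * P3 = P3 * y" "r * P3 = P3 * r" "w * P3 = P3 * w"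
    and "x * b1 = b1 * x" "y * b1 = b1 * y" "r * b1 = b1 * r"
    and "x * b2 = b2 * x" "y * b2 = b2 * y" "r * b2 = b2 * r"
    and "r * x = x * r" "r * y = y * r"
  shows "P1 * ((a1 * x + a2 * y) * r * (P2 * ((b1 * x + b2 * y) * w * P3))) =
    P1 * (a1 * (P2 * (b2 * P3))) * (x * y * r * w) + P1 * (a2 * (P2 * (b1 * P3))) * (y * x * r * w) +
    P1 * (a1 * (P2 * (b1 * P3))) * (x * x * r * w) + P1 * (a2 * (P2 * (b2 * P3))) * (y * y * r * w)"
  by (simp add: distrib_left distrib_right mult.assoc assms assms[THEN mult_assoc_lift] add_ac)

lemma prod_list_eq_0: "0 \<in> set xs \<Longrightarrow> prod_list xs = (0 :: 'a::semiring_1)"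
  by (induction xs) auto

lemma zvar_product4:
  "zvar a * zvar b * zvar c * zvar d =
     qpow (twist a b + (twist a c + twist b c) + (twist a d + twist b d + twist c d)) * qmonom {#a, b, c, d#}"
proof -
  have 2: "zvar a * zvar b = qpow (twist a b) * qmonom {#a, b#}"
    by (simp add: qmonom_mult add_mset_commute)
  have 3: "qmonom {#a, b#} * zvar c = qpow (twist a c + twist b c) * qmonom {#a, b, c#}"
    by (simp add: qmonom_mult cocycle_def add_mset_commute)
  have 4: "qmonom {#a, b, c#} * zvar d = qpow (twist a d + twist b d + twist c d) * qmonom {#a, b, c, d#}"
    by (simp add: qmonom_mult cocycle_def add_mset_commute add.assoc)
  show ?thesis
    by (simp add: 2 3 4 mult.assoc qpow_add mult_assoc_lift[OF 3])
qed

lemma prod_list_commute: "(\<And>x. x \<in> set xs \<Longrightarrow> z * x = x * z) \<Longrightarrow> z * prod_list xs = prod_list xs * (z :: 'a::monoid_mult)"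
  by (induction xs) (simp_all, metis mult.assoc)

context wiring
begin

definition path_product :: "nat \<Rightarrow> (nat \<Rightarrow> nat) \<Rightarrow> qtorus" where
  "path_product k v = prod_list (map (\<lambda>i. path_mat ss k i (v i)) [1..<Suc n])"

definition vars_upto :: "nat \<Rightarrow> (nat \<times> nat \<times> nat) multiset" where
  "vars_upto k = mset (filter (\<lambda>(h, j, c). j \<le> k) (wire_vars n ss))"

text \<open>The coefficient \<open>F\<close> for the diagram of the first \<open>k\<close> factors,
  with \<open>vars_upto k\<close> as its full product of variables.\<close>

definition path_coeff :: "nat \<Rightarrow> (nat \<Rightarrow> nat) \<Rightarrow> laurent" where
  "path_coeff k v = zcoeff (vars_upto k) (path_product k v)"

lemma count_vars_upto:
  "count (vars_upto k) (h, j, c) = (if (h, j, c) \<in> vars \<and> j \<le> k then 1 else 0)"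
proof -
  have "distinct (filter (\<lambda>(h, j, c). j \<le> k) (wire_vars n ss))"
    by (simp add: distinct_wire_vars)
  from this[unfolded distinct_count_atmost_1]
  have "count (vars_upto k) (h, j, c) = (if (h, j, c) \<in> set (filter (\<lambda>(h, j, c). j \<le> k) (wire_vars n ss)) then 1 else 0)"
    unfolding vars_upto_def by blast
  then show ?thesis by simp
qed

lemma vars_upto_0: "vars_upto 0 = {#}"
  by (rule multiset_eqI) (auto simp: count_vars_upto set_wire_vars split: prod.splits)

lemma vars_upto_length: "vars_upto (length ss) = mset (wire_vars n ss)"
proof -
  have "filter (\<lambda>(h, j, c). j \<le> length ss) (wire_vars n ss) = wire_vars n ss"
    by (rule filter_True) (auto simp: set_wire_vars)
  then show ?thesis by (simp add: vars_upto_def)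
qed

lemma path_coeff_length: "path_coeff (length ss) v = torus_coeff v"
  by (simp only: path_coeff_def vars_upto_length path_product_def)

definition crossing_vars_mset :: "nat \<Rightarrow> (nat \<times> nat \<times> nat) multiset" where
  "crossing_vars_mset j = (let s = crossing ss j in {#(s, j, 1), (Suc s, j, 1), (s, j, 2), (Suc s, j, 2)#})"

lemma vars_upto_Suc:
  assumes "k < length ss"
  shows "vars_upto (Suc k) = vars_upto k + crossing_vars_mset (Suc k)"
proof (rule multiset_eqI)
  fix v :: "nat \<times> nat \<times> nat"
  obtain h j c where v: "v = (h, j, c)" by (cases v)
  have "count (crossing_vars_mset (Suc k)) (h, j, c) = (if (h, j, c) \<in> vars \<and> j = Suc k then 1 else 0)"
    using assms crossing_bounds[of "Suc k"]
    by (auto simp: crossing_vars_mset_def Let_def set_wire_vars crossing_levels_def)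
  then show "count (vars_upto (Suc k)) v = count (vars_upto k + crossing_vars_mset (Suc k)) v"
    by (auto simp: v count_vars_upto)
qed

lemma path_coeff_0:
  assumes "v permutes {1..n}"
  shows "path_coeff 0 v = (if v = id then 1 else 0)"
proof (cases "v = id")
  case True
  have "path_product 0 v = 1"
    using True by (simp add: path_product_def map_replicate_const)
  also have "1 = qmonom {#}"
    by (simp add: qmonom_def flip: zero_qmon_def)
  finally show ?thesis using True by (simp add: path_coeff_def vars_upto_0 zcoeff_qmonom)
next
  case False
  then obtain i where "v i \<noteq> i" by fastforce
  moreover from this have "i \<in> {1..n}" using assms by (meson permutes_not_in)
  ultimately have "0 \<in> set (map (\<lambda>i. path_mat ss 0 i (v i)) [1..<Suc n])"
    by force
  then have "path_product 0 v = 0"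
    unfolding path_product_def by (rule prod_list_eq_0)
  then show ?thesis using False by (simp add: path_coeff_def)
qed

lemma path_product_split:
  assumes "1 \<le> a" "a < b" "b \<le> n"
  shows "path_product k v =
    prod_list (map (\<lambda>i. path_mat ss k i (v i)) [1..<a]) * (path_mat ss k a (v a) *
    (prod_list (map (\<lambda>i. path_mat ss k i (v i)) [Suc a..<b]) * (path_mat ss k b (v b) *
     prod_list (map (\<lambda>i. path_mat ss k i (v i)) [Suc b..<Suc n]))))"
proof -
  have "[1..<Suc n] = [1..<a] @ [a..<Suc n]"
    using assms upt_add_eq_append[of 1 a "Suc n - a"] by simp
  also have "[a..<Suc n] = a # [Suc a..<Suc n]"
    using assms by (simp add: upt_conv_Cons del: upt_Suc)
  also have "[Suc a..<Suc n] = [Suc a..<b] @ [b..<Suc n]"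
    using assms upt_add_eq_append[of "Suc a" b "Suc n - b"] by simp
  also have "[b..<Suc n] = b # [Suc b..<Suc n]"
    using assms by (simp add: upt_conv_Cons del: upt_Suc)
  finally show ?thesis
    unfolding path_product_def by (simp del: upt_Suc)
qed

text \<open>The sources \<open>a\<close> and \<open>b\<close> are those whose paths end on the two
  levels of the crossing. \<open>X\<close> and \<open>Y\<close> belong to the terms in which both
  paths enter through the same level; such terms repeat a variable and will drop out of the
  coefficient.\<close>

lemma path_product_Suc:
  fixes k v
  defines "s \<equiv> crossing ss (Suc k)"
  defines "z \<equiv> \<lambda>h. zvar (h, Suc k, 1)" and "z' \<equiv> \<lambda>h. zvar (h, Suc k, 2)"
  assumes ab: "1 \<le> a" "a < b" "b \<le> n"
    and inj: "inj v" and vab: "v a = s \<and> v b = Suc s \<or> v a = Suc s \<and> v b = s"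
  shows "\<exists>X Y. path_product (Suc k) v =
    path_product k v * (z (v a) * z (v b) * z' (v a) * z' (v b)) +
    path_product k (Transposition.transpose s (Suc s) \<circ> v) * (z (v b) * z (v a) * z' (v a) * z' (v b)) +
    X * (z (v a) * z (v a) * z' (v a) * z' (v b)) + Y * (z (v b) * z (v b) * z' (v a) * z' (v b))"
proof -
  let ?t = "Transposition.transpose s (Suc s)"
  let ?B = "path_mat ss k"
  have other: "v i \<noteq> s \<and> v i \<noteq> Suc s" if "i \<noteq> a" "i \<noteq> b" for i
    using vab that injD[OF inj] by metis
  define P where "P = (\<lambda>xs. prod_list (map (\<lambda>i. ?B i (v i)) xs))"
  have PS: "prod_list (map (\<lambda>i. path_mat ss (Suc k) i (v i)) xs) = P xs"
    and Pt: "prod_list (map (\<lambda>i. ?B i ((?t \<circ> v) i)) xs) = P xs" if "a \<notin> set xs" "b \<notin> set xs" for xs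
  proof -
    have ne: "v i \<noteq> s" "v i \<noteq> Suc s" if "i \<in> set xs" for i
      using other[of i] that \<open>a \<notin> set xs\<close> \<open>b \<notin> set xs\<close> by metis+
    show "prod_list (map (\<lambda>i. path_mat ss (Suc k) i (v i)) xs) = P xs"
      unfolding P_def by (rule arg_cong[of _ _ prod_list], rule map_cong)
        (use ne in \<open>auto simp: Let_def s_def[symmetric]\<close>)
    show "prod_list (map (\<lambda>i. ?B i ((?t \<circ> v) i)) xs) = P xs"
      unfolding P_def by (rule arg_cong[of _ _ prod_list], rule map_cong)
        (use ne in \<open>auto simp: transpose_def\<close>)
  qed
  have C: "path_mat ss (Suc k) i (v c) = (?B i (v a) * z (v a) + ?B i (v b) * z (v b)) * z' (v c)"
    if "c \<in> {a, b}" for i c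
    using vab that by (auto simp: Let_def s_def[symmetric] z_def z'_def add.commute)
  have comm: "z h * ?B i l = ?B i l * z h" "z' h * ?B i l = ?B i l * z' h" for h i l
    unfolding z_def z'_def by (rule zvar_path_mat_comm, simp)+
  have commP: "z h * P xs = P xs * z h" "z' h * P xs = P xs * z' h" for h xs
    unfolding P_def by (rule prod_list_commute, use comm in auto)+
  have zz': "z' h * z h' = z h' * z' h" for h h'
    unfolding z_def z'_def by (rule zvar_comm) simp
  have t: "(?t \<circ> v) a = v b" "(?t \<circ> v) b = v a"
    using vab by (auto simp: transpose_def)
  have ne: "a \<notin> set [1..<a]" "b \<notin> set [1..<a]" "a \<notin> set [Suc a..<b]" "b \<notin> set [Suc a..<b]"
    "a \<notin> set [Suc b..<Suc n]" "b \<notin> set [Suc b..<Suc n]"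
    using ab by auto
  let ?P1 = "P [1..<a]" and ?P2 = "P [Suc a..<b]" and ?P3 = "P [Suc b..<Suc n]"
  have "path_product (Suc k) v = ?P1 * ((?B a (v a) * z (v a) + ?B a (v b) * z (v b)) * z' (v a) *
      (?P2 * ((?B b (v a) * z (v a) + ?B b (v b) * z (v b)) * z' (v b) * ?P3)))"
    unfolding path_product_split[OF ab] using ne by (simp only: PS C insert_iff simp_thms)
  also have "\<dots> = ?P1 * (?B a (v a) * (?P2 * (?B b (v b) * ?P3))) * (z (v a) * z (v b) * z' (v a) * z' (v b)) +
      ?P1 * (?B a (v b) * (?P2 * (?B b (v a) * ?P3))) * (z (v b) * z (v a) * z' (v a) * z' (v b)) +
      ?P1 * (?B a (v a) * (?P2 * (?B b (v a) * ?P3))) * (z (v a) * z (v a) * z' (v a) * z' (v b)) +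
      ?P1 * (?B a (v b) * (?P2 * (?B b (v b) * ?P3))) * (z (v b) * z (v b) * z' (v a) * z' (v b))"
    by (rule crossing_product_expand) (rule comm commP zz')+
  also have "?P1 * (?B a (v a) * (?P2 * (?B b (v b) * ?P3))) = path_product k v"
    unfolding path_product_split[OF ab] P_def ..
  also have "?P1 * (?B a (v b) * (?P2 * (?B b (v a) * ?P3))) = path_product k (?t \<circ> v)"
    unfolding path_product_split[OF ab] t using ne by (simp only: Pt simp_thms)
  finally show ?thesis by blast
qed

lemma path_coeff_Suc:
  fixes k v
  defines "s \<equiv> crossing ss (Suc k)"
  assumes k: "k < length ss" and v: "v permutes {1..n}"
  shows "path_coeff (Suc k) v =
    (if inv_into UNIV v s < inv_into UNIV v (Suc s) then path_coeff k v else q_var * path_coeff k v)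
    + qhalf 1 * path_coeff k (Transposition.transpose s (Suc s) \<circ> v)"
proof -
  let ?t = "Transposition.transpose s (Suc s)"
  let ?Q = "crossing_vars_mset (Suc k)"
  define z where "z = (\<lambda>h. zvar (h, Suc k, 1))"
  define z' where "z' = (\<lambda>h. zvar (h, Suc k, 2))"
  have Q: "?Q = {#(s, Suc k, 1), (Suc s, Suc k, 1), (s, Suc k, 2), (Suc s, Suc k, 2)#}"
    by (simp add: crossing_vars_mset_def Let_def s_def)
  \<comment> \<open>Reordering across different crossings is free, and \<open>vars_upto k\<close>
    has no variable of crossing \<open>k + 1\<close>.\<close>
  have cQ: "cocycle (vars_upto k) ?Q = 0"
  proof (rule cocycle_eq_0)
    fix x y assume x: "x \<in># vars_upto k" and y: "y \<in># ?Q"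
    obtain h j c where hjc: "x = (h, j, c)" by (cases x)
    have "j \<le> k"
      using x count_vars_upto[of k h j c] unfolding hjc by (auto simp: count_eq_zero_iff split: if_splits)
    then show "twist x y = 0"
      using y unfolding hjc Q by auto
  qed
  have good: "zcoeff (vars_upto (Suc k)) (X * (qpow c * qmonom ?Q)) = qhalf c * zcoeff (vars_upto k) X" for X c
    unfolding qpow_left_comm zcoeff_qpow vars_upto_Suc[OF k] zcoeff_mult_qmonom cQ
    by (simp add: qhalf_def flip: single_one)
  have good0: "zcoeff (vars_upto (Suc k)) (X * qmonom ?Q) = zcoeff (vars_upto k) X" for X
    using good[of X 0] by (simp add: qhalf_def)
  \<comment> \<open>An entering variable occurs twice here but at most once in the product whose
    coefficient is taken.\<close>
  have bad: "zcoeff (vars_upto (Suc k)) (X * (z h * z h * z' h' * z' h'')) = 0" for X h h' h''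
  proof -
    let ?R = "{#(h, Suc k, 1), (h, Suc k, 1), (h', Suc k, 2), (h'', Suc k, 2 :: nat)#}"
    have "\<exists>c. z h * z h * z' h' * z' h'' = qpow c * qmonom ?R"
      unfolding z_def z'_def zvar_product4 by blast
    moreover have "\<not> ?R \<subseteq># vars_upto (Suc k)"
    proof
      assume "?R \<subseteq># vars_upto (Suc k)"
      then have "count ?R (h, Suc k, 1) \<le> count (vars_upto (Suc k)) (h, Suc k, 1)"
        by (rule mset_subset_eq_count)
      then show False by (simp add: count_vars_upto split: if_splits)
    qed
    ultimately show ?thesis
      by (auto simp: qpow_left_comm zcoeff_qpow zcoeff_mult_qmonom_eq_0)
  qed
  \<comment> \<open>The exponent is the number of pairs, entering and leaving, that list the upper
    level first.\<close>
  have z1: "z s * z (Suc s) * z' s * z' (Suc s) = qmonom ?Q"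
    and z2: "z (Suc s) * z s * z' s * z' (Suc s) = qpow 1 * qmonom ?Q"
    and z3: "z (Suc s) * z s * z' (Suc s) * z' s = qpow 2 * qmonom ?Q"
    and z4: "z s * z (Suc s) * z' (Suc s) * z' s = qpow 1 * qmonom ?Q"
    unfolding z_def z'_def Q
    by (simp_all add: zvar_product4 add_mset_commute)
  have inj: "inj v" and surj: "surj v" using v permutes_inj permutes_surj by blast+
  \<comment> \<open>\<open>?u h\<close> is the source whose path ends on level
    \<open>h\<close>.\<close>
  let ?u = "inv_into UNIV v"
  have vu: "v (?u x) = x" for x using surj by (rule surj_f_inv_f)
  have "s \<in> {1..<n}" using crossing_bounds[of "Suc k"] k by (simp add: s_def)
  then have range: "?u s \<in> {1..n}" "?u (Suc s) \<in> {1..n}"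
    using permutes_in_image[OF permutes_inv[OF v]] by simp_all
  have ne: "?u s \<noteq> ?u (Suc s)" using vu by (metis n_not_Suc_n)
  show ?thesis
  proof (cases "?u s < ?u (Suc s)")
    case True
    obtain X Y where "path_product (Suc k) v =
      path_product k v * (z s * z (Suc s) * z' s * z' (Suc s)) +
      path_product k (?t \<circ> v) * (z (Suc s) * z s * z' s * z' (Suc s)) +
      X * (z s * z s * z' s * z' (Suc s)) + Y * (z (Suc s) * z (Suc s) * z' s * z' (Suc s))"
      using path_product_Suc[of "?u s" "?u (Suc s)" v k, OF _ True _ inj] range
      unfolding vu s_def[symmetric] z_def z'_def by auto
    then show ?thesis
      using True unfolding path_coeff_def by (simp add: zcoeff_add bad z1 z2 good good0)
  next
    case False
    then have "?u (Suc s) < ?u s" using ne by simp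
    obtain X Y where "path_product (Suc k) v =
      path_product k v * (z (Suc s) * z s * z' (Suc s) * z' s) +
      path_product k (?t \<circ> v) * (z s * z (Suc s) * z' (Suc s) * z' s) +
      X * (z (Suc s) * z (Suc s) * z' (Suc s) * z' s) + Y * (z s * z s * z' (Suc s) * z' s)"
      using path_product_Suc[of "?u (Suc s)" "?u s" v k, OF _ \<open>?u (Suc s) < ?u s\<close> _ inj] range
      unfolding vu s_def[symmetric] z_def z'_def by auto
    then show ?thesis
      using False unfolding path_coeff_def by (simp add: zcoeff_add bad z3 z4 good)
  qed
qed

end


section \<open>Length and descents of permutations\<close>

declare One_nat_def [simp del]

abbreviation adj :: "nat \<Rightarrow> nat \<Rightarrow> nat" where
  "adj s \<equiv> Transposition.transpose s (Suc s)"

definition inversions :: "nat \<Rightarrow> (nat \<Rightarrow> nat) \<Rightarrow> (nat \<times> nat) set" where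
  "inversions n u = {(a, b). 1 \<le> a \<and> a < b \<and> b \<le> n \<and> u b < u a}"

lemma finite_inversions: "finite (inversions n u)"
  by (rule finite_subset[of _ "{..n} \<times> {..n}"]) (auto simp: inversions_def)

lemma adj_adj [simp]: "adj s (adj s x) = x"
  by (auto simp: transpose_def)

lemma adj_comp_adj: "adj s \<circ> (adj s \<circ> w) = w" "w \<circ> adj s \<circ> adj s = w"
  by (auto simp: fun_eq_iff)

lemma adj_less: "a < b \<Longrightarrow> (a, b) \<noteq> (s, Suc s) \<Longrightarrow> adj s a < adj s b"
  by (auto simp: transpose_def)

lemma adj_range: "s \<in> {1..<n} \<Longrightarrow> 1 \<le> adj s a \<longleftrightarrow> 1 \<le> a" "s \<in> {1..<n} \<Longrightarrow> adj s a \<le> n \<longleftrightarrow> a \<le> n"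
  by (auto simp: transpose_def)

lemma adj_permutes: "s \<in> {1..<n} \<Longrightarrow> adj s permutes {1..n}"
  by (rule permutes_swap_id) auto

text \<open>Exchanging two adjacent positions preserves the order of every pair of positions except
  \<open>(s, Suc s)\<close>, so the old inversions are carried over bijectively and this one pair is
  added.\<close>

lemma card_inversions_up:
  assumes s: "s \<in> {1..<n}" and up: "u s < u (Suc s)"
  shows "card (inversions n (u \<circ> adj s)) = Suc (card (inversions n u))"
proof -
  let ?f = "\<lambda>(a, b). (adj s a, adj s b)"
  have "inversions n (u \<circ> adj s) = insert (s, Suc s) (?f ` inversions n u)" (is "?L = ?R")
  proof (rule Set.set_eqI)
    fix ab :: "nat \<times> nat"
    obtain a b where ab: "ab = (a, b)" by (cases ab)
    have "(a, b) \<in> ?f ` inversions n u \<longleftrightarrow> (adj s a, adj s b) \<in> inversions n u"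
      by (auto simp: image_iff intro!: bexI[of _ "(adj s a, adj s b)"])
    moreover have "(adj s s, adj s (Suc s)) \<notin> inversions n u"
      by (simp add: inversions_def)
    moreover have "(s, Suc s) \<in> ?L"
      using s up by (simp add: inversions_def)
    moreover have "(adj s a, adj s b) \<in> inversions n u \<longleftrightarrow> (a, b) \<in> ?L" if "(a, b) \<noteq> (s, Suc s)"
    proof -
      have "adj s a < adj s b \<longleftrightarrow> a < b" if "u (adj s b) < u (adj s a)"
      proof
        assume "adj s a < adj s b"
        moreover have "(adj s a, adj s b) \<noteq> (s, Suc s)" using that up by auto
        ultimately show "a < b" using adj_less[of "adj s a" "adj s b" s] by simp
      qed (use \<open>(a, b) \<noteq> (s, Suc s)\<close> adj_less in blast)
      then show ?thesis
        using s by (auto simp: inversions_def adj_range)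
    qed
    ultimately show "ab \<in> ?L \<longleftrightarrow> ab \<in> ?R" unfolding ab by blast
  qed
  moreover have "(s, Suc s) \<notin> ?f ` inversions n u"
    by (auto simp: inversions_def transpose_def split: if_splits)
  moreover have "inj_on ?f (inversions n u)"
    by (auto simp: inj_on_def) (metis adj_adj)+
  ultimately show ?thesis
    by (simp add: card_image finite_inversions)
qed

text \<open>The inversions are counted in the inverse permutation because appending a factor \<open>s\<close> to
  an expression exchanges the values \<open>s\<close> and \<open>s + 1\<close> of its one-line notation.\<close>

definition inv_count :: "nat \<Rightarrow> (nat \<Rightarrow> nat) \<Rightarrow> nat" where
  "inv_count n w = card (inversions n (inv_into UNIV w))"

text \<open>The letter \<open>s + 1\<close> stands to the left of \<open>s\<close> in the one-line
  notation; equivalently, some reduced expression of \<open>w\<close> ends in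
  \<open>s\<close>.\<close>

definition descent :: "nat \<Rightarrow> (nat \<Rightarrow> nat) \<Rightarrow> bool" where
  "descent s w \<longleftrightarrow> inv_into UNIV w (Suc s) < inv_into UNIV w s"

lemma inv_adj_comp: "w permutes S \<Longrightarrow> inv_into UNIV (adj s \<circ> w) = inv_into UNIV w \<circ> adj s"
  by (subst o_inv_distrib) (auto simp: permutes_bij)

lemma not_descent:
  assumes "w permutes S" "\<not> descent s w"
  shows "inv_into UNIV w s < inv_into UNIV w (Suc s)"
proof -
  have "inv_into UNIV w s \<noteq> inv_into UNIV w (Suc s)"
    using permutes_inj[OF permutes_inv[OF assms(1)]] by (metis injD n_not_Suc_n)
  then show ?thesis using assms(2) by (simp add: descent_def)
qed

lemma descent_adj: "w permutes S \<Longrightarrow> descent s (adj s \<circ> w) \<longleftrightarrow> \<not> descent s w"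
  using not_descent[of w S s] by (auto simp: descent_def inv_adj_comp)

lemma inv_count_up:
  "w permutes {1..n} \<Longrightarrow> s \<in> {1..<n} \<Longrightarrow> \<not> descent s w \<Longrightarrow> inv_count n (adj s \<circ> w) = Suc (inv_count n w)"
  unfolding inv_count_def using card_inversions_up not_descent inv_adj_comp by metis

lemma adj_comp_permutes: "w permutes {1..n} \<Longrightarrow> s \<in> {1..<n} \<Longrightarrow> adj s \<circ> w permutes {1..n}"
  using permutes_compose adj_permutes by blast

lemma inv_count_down:
  assumes "w permutes {1..n}" "s \<in> {1..<n}" "descent s w"
  shows "inv_count n w = Suc (inv_count n (adj s \<circ> w))"
  using inv_count_up[OF adj_comp_permutes[OF assms(1,2)] assms(2)] assms descent_adj[OF assms(1)]
  by (simp add: adj_comp_adj)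

section \<open>Expressions and the length function\<close>

lemma expr_perm_Cons: "expr_perm (s # ss) = expr_perm ss \<circ> adj s"
  by (simp add: expr_perm_def)

lemma expr_perm_Nil [simp]: "expr_perm [] = id"
  by (simp add: expr_perm_def)

lemma expr_perm_snoc: "expr_perm (ss @ [s]) = adj s \<circ> expr_perm ss"
  by (induction ss) (simp_all add: expr_perm_Cons comp_assoc)

lemma is_expression_snoc: "is_expression n (ss @ [s]) \<longleftrightarrow> is_expression n ss \<and> s \<in> {1..<n}"
  by (auto simp: is_expression_def)

lemma expr_perm_permutes: "is_expression n ss \<Longrightarrow> expr_perm ss permutes {1..n}"
  by (induction ss rule: rev_induct)
    (auto simp: expr_perm_snoc is_expression_snoc permutes_id simp flip: id_def intro!: adj_comp_permutes)

lemma inv_count_id [simp]: "inv_count n id = 0"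
proof -
  have "inversions n (inv_into UNIV id) = {}" by (auto simp: inversions_def)
  then show ?thesis by (simp only: inv_count_def card.empty)
qed

lemma inv_count_expr_perm: "is_expression n ss \<Longrightarrow> inv_count n (expr_perm ss) \<le> length ss"
proof (induction ss rule: rev_induct)
  case Nil
  show ?case unfolding expr_perm_Nil inv_count_id by simp
next
  case (snoc s ss)
  then have ss: "is_expression n ss" "s \<in> {1..<n}" "inv_count n (expr_perm ss) \<le> length ss"
    by (auto simp: is_expression_snoc)
  show ?case
    unfolding expr_perm_snoc
    using inv_count_up[OF expr_perm_permutes[OF ss(1)] ss(2)]
      inv_count_down[OF expr_perm_permutes[OF ss(1)] ss(2)] ss(3)
    by (cases "descent s (expr_perm ss)") (simp_all add: comp_def)
qed

text \<open>Without a descent the inverse increases along \<open>{1..n}\<close>, so it moves no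
  position downward, and such a permutation is the identity.\<close>

lemma ex_descent:
  assumes "w permutes {1..n}" "w \<noteq> id"
  shows "\<exists>s\<in>{1..<n}. descent s w"
proof (rule ccontr)
  let ?u = "inv_into UNIV w"
  assume "\<not> ?thesis"
  then have up: "?u s < ?u (Suc s)" if "s \<in> {1..<n}" for s
    using not_descent[OF assms(1)] that by blast
  have u: "?u permutes {1..n}" using permutes_inv[OF assms(1)] .
  have ge: "1 \<le> i \<Longrightarrow> i \<le> n \<longrightarrow> i \<le> ?u i" for i
  proof (induction i rule: nat_induct_at_least)
    case base
    then show ?case using permutes_in_image[OF u, of 1] by auto
  next
    case (Suc i)
    then show ?case using up[of i] by fastforce
  qed
  have "?u = id"
    by (rule permutes_natset_ge[OF u]) (use ge in auto)
  then have "w = id"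
    using assms(1) by (metis inv_id permutes_inv_inv)
  with assms(2) show False by simp
qed

lemma ex_expression:
  "w permutes {1..n} \<Longrightarrow> \<exists>ss. is_expression n ss \<and> expr_perm ss = w \<and> length ss = inv_count n w"
proof (induction "inv_count n w" arbitrary: w rule: less_induct)
  case less
  show ?case
  proof (cases "w = id")
    case True
    then show ?thesis by (intro exI[of _ "[]"]) (simp add: is_expression_def)
  next
    case False
    then obtain s where s: "s \<in> {1..<n}" "descent s w"
      using ex_descent less.prems by blast
    note down = inv_count_down[OF less.prems s]
    obtain ss where "is_expression n ss" "expr_perm ss = adj s \<circ> w" "length ss = inv_count n (adj s \<circ> w)"
      using less.hyps[of "adj s \<circ> w"] down adj_comp_permutes[OF less.prems s(1)] by auto
    then show ?thesis
      using s down by (intro exI[of _ "ss @ [s]"]) (simp add: is_expression_snoc expr_perm_snoc adj_comp_adj)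
  qed
qed

text \<open>Stripping descents one at a time yields an expression with \<open>inv_count n w\<close>
  factors, and none is shorter because each factor changes the inversion count by one.\<close>

lemma perm_length_eq_inv_count:
  assumes "w permutes {1..n}"
  shows "perm_length n w = inv_count n w"
  unfolding perm_length_def
  by (rule Least_equality) (use ex_expression[OF assms] inv_count_expr_perm in auto)

lemma reduced_expression_iff:
  "w permutes {1..n} \<Longrightarrow> reduced_expression n w ss \<longleftrightarrow>
     is_expression n ss \<and> expr_perm ss = w \<and> length ss = inv_count n w"
  by (simp add: reduced_expression_def perm_length_eq_inv_count)

lemma ex_reduced_expression: "w permutes {1..n} \<Longrightarrow> \<exists>ss. reduced_expression n w ss"
  using ex_expression reduced_expression_iff by metis

lemma reduced_expression_snocI:
  assumes "w permutes {1..n}" "s \<in> {1..<n}" "descent s w" "reduced_expression n (adj s \<circ> w) ss"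
  shows "reduced_expression n w (ss @ [s])"
  using assms inv_count_down[OF assms(1-3)]
  by (simp add: reduced_expression_iff adj_comp_permutes is_expression_snoc expr_perm_snoc adj_comp_adj)

lemma reduced_expression_snocD:
  assumes w: "w permutes {1..n}" and red: "reduced_expression n w (ss @ [s])"
  shows "s \<in> {1..<n}" "descent s w" "reduced_expression n (adj s \<circ> w) ss"
proof -
  have *: "is_expression n ss" "s \<in> {1..<n}" "adj s \<circ> expr_perm ss = w" "Suc (length ss) = inv_count n w"
    using red by (simp_all add: reduced_expression_iff[OF w] is_expression_snoc expr_perm_snoc)
  have eq: "expr_perm ss = adj s \<circ> w"
    using *(3) by (auto simp: adj_comp_adj)
  show "s \<in> {1..<n}" by fact
  show d: "descent s w"
  proof (rule ccontr)
    \<comment> \<open>Otherwise removing the last factor would leave a permutation with more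
      inversions than its expression has letters.\<close>
    assume "\<not> descent s w"
    then show False
      using inv_count_up[OF w *(2)] inv_count_expr_perm[OF *(1)] *(4) eq by simp
  qed
  show "reduced_expression n (adj s \<circ> w) ss"
    using inv_count_down[OF w *(2) d] * eq
    by (simp add: reduced_expression_iff adj_comp_permutes[OF w *(2)])
qed

section \<open>Descents under the braid moves\<close>

lemma adj_braid: "\<bar>int s - int t\<bar> = 1 \<Longrightarrow> adj s \<circ> (adj t \<circ> (adj s \<circ> w)) = adj t \<circ> (adj s \<circ> (adj t \<circ> w))"
  by (auto simp: fun_eq_iff transpose_def)

lemma adj_commute: "\<bar>int s - int t\<bar> \<ge> 2 \<Longrightarrow> adj s \<circ> (adj t \<circ> w) = adj t \<circ> (adj s \<circ> w)"
  by (auto simp: fun_eq_iff transpose_def)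

lemma descent_commute:
  "w permutes S \<Longrightarrow> \<bar>int s - int t\<bar> \<ge> 2 \<Longrightarrow> descent t (adj s \<circ> w) \<longleftrightarrow> descent t w"
  by (auto simp add: descent_def inv_adj_comp transpose_def)

text \<open>Two neighbouring descents force the three letters involved to stand in decreasing order,
  so the three factors of either side of the braid relation can be stripped from the end one by
  one.\<close>

lemma descent_braid:
  assumes w: "w permutes {1..n}" and s: "s \<in> {1..<n}" and t: "t \<in> {1..<n}" and st: "\<bar>int s - int t\<bar> = 1"
    and d: "descent s w" "descent t w"
  shows "descent t (adj s \<circ> w)" "descent s (adj t \<circ> (adj s \<circ> w))"
proof -
  note w' = adj_comp_permutes[OF w s]
  have "t = Suc s \<or> s = Suc t" using st by auto
  then show "descent t (adj s \<circ> w)" "descent s (adj t \<circ> (adj s \<circ> w))"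
    using d by (auto simp: descent_def inv_adj_comp[OF w] inv_adj_comp[OF w'] transpose_def)
qed


section \<open>The standard basis elements of the Hecke algebra\<close>

definition hecke_letters :: "nat \<Rightarrow> nat set" where
  "hecke_letters n = {1..<n}"

locale hecke_algebra =
  fixes n :: nat
begin

sublocale presentation "hecke_letters n" "hecke_rels n"
proof
  show "hecke_rels n \<subseteq> carrier (free_algebra (hecke_letters n))"
    unfolding hecke_rels_def hecke_letters_def by (auto intro!: free_closed)
qed

notation rel_cong (infix "\<approx>" 50)

lemma hecke_eq: "hecke n = A"
  by (simp add: hecke_def hecke_letters_def)

lemma hecke_gen_cls: "hecke_gen n i = cls (fvar i)"
  unfolding hecke_gen_def hecke_letters_def[symmetric] by (rule presented_gen_cls)

lemma gen_closed: "s \<in> {1..<n} \<Longrightarrow> fvar s \<in> carrier F"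
  by (simp add: fvar_closed hecke_letters_def)

lemma quadratic: "s \<in> {1..<n} \<Longrightarrow> fvar s * fvar s \<approx> fscalar (q_var - 1) * fvar s + fscalar q_var"
  unfolding rel_cong_def by (rule rel_in_ideal) (auto simp: hecke_rels_def)

lemma braid:
  "s \<in> {1..<n} \<Longrightarrow> t \<in> {1..<n} \<Longrightarrow> \<bar>int s - int t\<bar> = 1 \<Longrightarrow>
    fvar s * fvar t * fvar s \<approx> fvar t * fvar s * fvar t"
  unfolding rel_cong_def by (rule rel_in_ideal) (auto simp: hecke_rels_def)

lemma commute:
  "s \<in> {1..<n} \<Longrightarrow> t \<in> {1..<n} \<Longrightarrow> \<bar>int s - int t\<bar> \<ge> 2 \<Longrightarrow> fvar s * fvar t \<approx> fvar t * fvar s"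
  unfolding rel_cong_def by (rule rel_in_ideal) (auto simp: hecke_rels_def)

definition word_prod :: "nat list \<Rightarrow> nat freealg" where
  "word_prod ss = prod_list (map fvar ss)"

lemma word_prod_closed: "is_expression n ss \<Longrightarrow> word_prod ss \<in> carrier F"
  unfolding word_prod_def is_expression_def
  by (intro free_algebra_prod_list_closed) (auto intro!: gen_closed)

text \<open>Matsumoto's theorem: if two reduced expressions of \<open>w\<close> end in different letters \<open>s\<close> and
  \<open>t\<close>, then \<open>w\<close> also has reduced expressions that end in the two sides of the braid relation
  between \<open>s\<close> and \<open>t\<close> and agree before that.\<close>

theorem word_prod_reduced_cong:
  assumes "w permutes {1..n}" "reduced_expression n w ss" "reduced_expression n w ss'"
  shows "word_prod ss \<approx> word_prod ss'"
  using assms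
proof (induction "inv_count n w" arbitrary: w ss ss' rule: less_induct)
  case less
  note w = less.prems(1)
  have len: "length ss = inv_count n w" "length ss' = inv_count n w"
    using less.prems by (auto simp: reduced_expression_iff)
  show ?case
  proof (cases ss rule: rev_cases)
    case Nil
    with len show ?thesis by simp
  next
    case ss: (snoc a s)
    with len obtain b t where ss': "ss' = b @ [t]"
      by (cases ss' rule: rev_cases) auto
    note a = reduced_expression_snocD[OF w less.prems(2)[unfolded ss]]
    note b = reduced_expression_snocD[OF w less.prems(3)[unfolded ss']]
    note ws = adj_comp_permutes[OF w a(1)] and wt = adj_comp_permutes[OF w b(1)]
    have IH: "word_prod a \<approx> word_prod c" if "reduced_expression n (adj s \<circ> w) c" for c
      using less.hyps[OF _ ws a(3) that] inv_count_down[OF w a(1,2)] by simp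
    have IH': "word_prod b \<approx> word_prod c" if "reduced_expression n (adj t \<circ> w) c" for c
      using less.hyps[OF _ wt b(3) that] inv_count_down[OF w b(1,2)] by simp
    have step: "word_prod ss \<approx> word_prod (c @ [s])" if "reduced_expression n (adj s \<circ> w) c" for c
      using cong_mult_right[OF IH[OF that] gen_closed[OF a(1)]]
      by (simp add: ss word_prod_def)
    have step': "word_prod ss' \<approx> word_prod (c @ [t])" if "reduced_expression n (adj t \<circ> w) c" for c
      using cong_mult_right[OF IH'[OF that] gen_closed[OF b(1)]]
      by (simp add: ss' word_prod_def)
    consider "s = t" | "\<bar>int s - int t\<bar> \<ge> 2" | "\<bar>int s - int t\<bar> = 1" by linarith
    then show ?thesis
    proof cases
      case 1
      with step[of b] b(3) show ?thesis by (simp add: ss')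
    next
      case 2
      then have two': "\<bar>int t - int s\<bar> \<ge> 2" by linarith
      obtain c where c: "reduced_expression n (adj t \<circ> (adj s \<circ> w)) c"
        using ex_reduced_expression adj_comp_permutes[OF ws b(1)] by blast
      have "reduced_expression n (adj s \<circ> w) (c @ [t])"
        by (rule reduced_expression_snocI[OF ws b(1) _ c]) (simp add: descent_commute[OF w 2] b(2))
      from step[OF this] have "word_prod ss \<approx> word_prod c * (fvar t * fvar s)"
        by (simp add: word_prod_def mult.assoc)
      also have "\<dots> \<approx> word_prod c * (fvar s * fvar t)"
        using c adj_comp_permutes[OF ws b(1)]
        by (intro cong_mult_left commute a b two' word_prod_closed) (simp add: reduced_expression_iff)
      also have "\<dots> \<approx> word_prod ss'"
      proof -
        have "reduced_expression n (adj t \<circ> w) (c @ [s])"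
          by (rule reduced_expression_snocI[OF wt a(1)])
            (simp_all add: descent_commute[OF w two'] a(2) c adj_commute[OF 2])
        from cong_sym[OF step'[OF this]] show ?thesis
          by (simp add: word_prod_def mult.assoc)
      qed
      finally show ?thesis .
    next
      case 3
      then have three': "\<bar>int t - int s\<bar> = 1" by linarith
      note d = descent_braid[OF w a(1) b(1) 3 a(2) b(2)]
      note d' = descent_braid[OF w b(1) a(1) three' b(2) a(2)]
      note wst = adj_comp_permutes[OF ws b(1)] and wts = adj_comp_permutes[OF wt a(1)]
      note wsts = adj_comp_permutes[OF wst a(1)]
      obtain c where c: "reduced_expression n (adj s \<circ> (adj t \<circ> (adj s \<circ> w))) c"
        using ex_reduced_expression wsts by blast
      have "reduced_expression n (adj s \<circ> w) ((c @ [s]) @ [t])"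
        by (intro reduced_expression_snocI ws wst a b d c)
      from step[OF this] have "word_prod ss \<approx> word_prod c * (fvar s * fvar t * fvar s)"
        by (simp add: word_prod_def mult.assoc)
      also have "\<dots> \<approx> word_prod c * (fvar t * fvar s * fvar t)"
        using c wsts by (intro cong_mult_left braid a b 3 word_prod_closed) (simp add: reduced_expression_iff)
      also have "\<dots> \<approx> word_prod ss'"
      proof -
        have "reduced_expression n (adj t \<circ> w) ((c @ [t]) @ [s])"
          by (intro reduced_expression_snocI wt wts a b d' c[unfolded adj_braid[OF 3]])
        from cong_sym[OF step'[OF this]] show ?thesis
          by (simp add: word_prod_def mult.assoc)
      qed
      finally show ?thesis .
    qed
  qed
qed

text \<open>A representative of \<open>hecke_T\<close> built from the same chosen expression, so the
  two correspond without any rewriting of words.\<close>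

definition T_word :: "(nat \<Rightarrow> nat) \<Rightarrow> nat freealg" where
  "T_word w = word_prod (SOME ss. reduced_expression n w ss)"

lemma T_word_cong:
  assumes "w permutes {1..n}" "reduced_expression n w ss"
  shows "T_word w \<approx> word_prod ss"
  unfolding T_word_def
  by (rule word_prod_reduced_cong[OF assms(1) someI_ex assms(2)]) (use assms in blast)

lemma some_reduced:
  assumes "w permutes {1..n}"
  shows "reduced_expression n w (SOME ss. reduced_expression n w ss)"
  using ex_reduced_expression[OF assms] by (rule someI_ex)

lemma T_word_closed: "w permutes {1..n} \<Longrightarrow> T_word w \<in> carrier F"
  unfolding T_word_def using some_reduced reduced_expression_iff word_prod_closed by blast

lemma hecke_T_cls:
  assumes "w permutes {1..n}"
  shows "hecke_T n w = cls (T_word w)"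
proof -
  have "is_expression n (SOME ss. reduced_expression n w ss)"
    using some_reduced[OF assms] by (simp add: reduced_expression_def)
  then show ?thesis
    unfolding hecke_T_def T_word_def word_prod_def hecke_eq hecke_gen_cls
    by (intro cls_prod_list gen_closed) (auto simp: is_expression_def)
qed

lemma T_word_id: "T_word id = 1"
proof -
  have "(SOME ss. reduced_expression n id ss) = []"
    using some_reduced[OF permutes_id] reduced_expression_iff[OF permutes_id] by auto
  then show ?thesis by (simp add: T_word_def word_prod_def)
qed

section \<open>Right multiplication by generators\<close>

lemma T_word_mult_up:
  assumes w: "w permutes {1..n}" and s: "s \<in> {1..<n}" and up: "\<not> descent s w"
  shows "T_word w * fvar s \<approx> T_word (adj s \<circ> w)"
proof -
  note w' = adj_comp_permutes[OF w s]
  have "reduced_expression n (adj s \<circ> w) ((SOME ss. reduced_expression n w ss) @ [s])"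
    by (rule reduced_expression_snocI[OF w' s])
      (use some_reduced[OF w] up in \<open>simp_all add: descent_adj[OF w] adj_comp_adj\<close>)
  from cong_sym[OF T_word_cong[OF w' this]] show ?thesis
    by (simp add: T_word_def word_prod_def)
qed

text \<open>A final \<open>s\<close> can be split off from \<open>w\<close>, and the quadratic
  relation applies to the resulting square.\<close>

lemma T_word_mult_down:
  assumes w: "w permutes {1..n}" and s: "s \<in> {1..<n}" and down: "descent s w"
  shows "T_word w * fvar s \<approx> fscalar (q_var - 1) * T_word w + fscalar q_var * T_word (adj s \<circ> w)"
proof -
  define w' where "w' = adj s \<circ> w"
  have w': "w' permutes {1..n}" "\<not> descent s w'" "adj s \<circ> w' = w"
    using adj_comp_permutes[OF w s] down by (simp_all add: w'_def descent_adj[OF w] adj_comp_adj)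
  have *: "T_word w' * fvar s \<approx> T_word w"
    using T_word_mult_up[OF w'(1) s w'(2)] by (simp add: w'(3))
  have "T_word w * fvar s \<approx> T_word w' * fvar s * fvar s"
    by (rule cong_mult_right[OF cong_sym[OF *] gen_closed[OF s]])
  also have "\<dots> = T_word w' * (fvar s * fvar s)"
    by (simp add: mult.assoc)
  also have "\<dots> \<approx> T_word w' * (fscalar (q_var - 1) * fvar s + fscalar q_var)"
    by (rule cong_mult_left[OF quadratic[OF s] T_word_closed[OF w'(1)]])
  also have "\<dots> = fscalar (q_var - 1) * (T_word w' * fvar s) + fscalar q_var * T_word w'"
    by (simp only: distrib_left fscalar_left_comm fscalar_comm[of q_var "T_word w'"])
  also have "\<dots> \<approx> fscalar (q_var - 1) * T_word w + fscalar q_var * T_word w'"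
    by (intro cong_add cong_mult_left * fscalar_closed) simp
  finally show ?thesis by (simp add: w'_def)
qed

text \<open>The quadratic relation says \<open>T_s (1 + T_s) = q (1 + T_s)\<close>. Hence both cases
  give a multiple of the same sum, symmetric under exchanging \<open>w\<close> with
  \<open>adj s \<circ> w\<close>.\<close>

lemma T_word_mult_one_plus:
  assumes w: "w permutes {1..n}" and s: "s \<in> {1..<n}"
  shows "T_word w * (1 + fvar s) \<approx>
    fscalar (if descent s w then q_var else 1) * (T_word w + T_word (adj s \<circ> w))"
proof (cases "descent s w")
  case True
  have "T_word w * (1 + fvar s) \<approx> T_word w + (fscalar (q_var - 1) * T_word w + fscalar q_var * T_word (adj s \<circ> w))"
    unfolding distrib_left mult_1_right
    by (intro cong_add T_word_mult_down[OF w s True]) simp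
  then show ?thesis
    using True by (simp add: fscalar_diff fscalar_one algebra_simps)
next
  case False
  have "T_word w * (1 + fvar s) \<approx> T_word w + T_word (adj s \<circ> w)"
    unfolding distrib_left mult_1_right
    by (intro cong_add T_word_mult_up[OF w s False]) simp
  then show ?thesis using False by (simp add: fscalar_one)
qed

lemma linear_on_cls_sum:
  assumes "linear_on (hecke n) (carrier (hecke n)) \<theta>" "finite S" "\<And>w. w \<in> S \<Longrightarrow> f w \<in> carrier F"
  shows "\<theta> (cls (\<Sum>w\<in>S. fscalar (c w) * f w)) = (\<Sum>w\<in>S. c w * \<theta> (cls (f w)))"
proof -
  have add: "\<theta> (a \<oplus>\<^bsub>A\<^esub> b) = \<theta> a + \<theta> b" if "a \<in> carrier A" "b \<in> carrier A" for a b
    using assms(1) that unfolding linear_on_def hecke_eq by blast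
  have smult: "\<theta> (c \<odot>\<^bsub>A\<^esub> a) = c * \<theta> a" if "a \<in> carrier A" for c a
    using assms(1) that unfolding linear_on_def hecke_eq by blast
  show ?thesis
    using assms(2,3)
  proof induction
    case empty
    have "0 \<odot>\<^bsub>A\<^esub> cls 0 = cls 0"
      by (simp add: cls_smult free_closed)
    then show ?case
      using smult[OF cls_closed[OF free_algebra_zero_closed], of 0] by simp
  next
    case (insert w S)
    let ?s = "\<Sum>w\<in>S. fscalar (c w) * f w"
    have cl: "fscalar (c w) * f w \<in> carrier F" "?s \<in> carrier F" "f w \<in> carrier F"
      using insert.prems by (auto intro!: free_closed)
    have "\<theta> (cls (fscalar (c w) * f w + ?s)) = \<theta> (cls (fscalar (c w) * f w)) + \<theta> (cls ?s)"
      using add[OF cls_closed[OF cl(1)] cls_closed[OF cl(2)]] by (simp add: cls_add cl)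
    also have "\<theta> (cls (fscalar (c w) * f w)) = c w * \<theta> (cls (f w))"
      using smult[OF cls_closed[OF cl(3)]] by (simp add: cls_smult cl)
    finally show ?case using insert by simp
  qed
qed

end


section \<open>Expansion in the Hecke algebra\<close>

locale hecke_wiring = wiring n ss + H: hecke_algebra n for n ss
begin

abbreviation perms :: "(nat \<Rightarrow> nat) set" where
  "perms \<equiv> {w. w permutes {1..n}}"

text \<open>The coordinate of the partial product at \<open>T_w\<close>. The power of
  \<open>q\<close> converts the transition factors \<open>1\<close> and \<open>q\<close> of the
  Hecke algebra into the factor \<open>q^(1/2)\<close> that \<open>path_coeff_Suc\<close> has in
  both directions.\<close>

definition hecke_coeff :: "nat \<Rightarrow> (nat \<Rightarrow> nat) \<Rightarrow> laurent" where
  "hecke_coeff k w = qhalf (- int (inv_count n w)) * path_coeff k w"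

lemma hecke_coeff_Suc:
  fixes k
  defines "s \<equiv> crossing ss (Suc k)"
  assumes k: "k < length ss" and w: "w permutes {1..n}"
  shows "hecke_coeff (Suc k) w =
    hecke_coeff k w * (if descent s w then q_var else 1) +
    hecke_coeff k (adj s \<circ> w) * (if descent s (adj s \<circ> w) then q_var else 1)"
proof -
  have s: "s \<in> {1..<n}" using crossing_bounds[of "Suc k"] k by (simp add: s_def)
  note rec = path_coeff_Suc[OF k w, folded s_def]
  show ?thesis
  proof (cases "descent s w")
    case True
    then have "\<not> inv_into UNIV w s < inv_into UNIV w (Suc s)" by (simp add: descent_def)
    then have "hecke_coeff (Suc k) w = qhalf (- int (inv_count n w)) *
        (q_var * path_coeff k w + qhalf 1 * path_coeff k (adj s \<circ> w))"
      using rec by (simp add: hecke_coeff_def)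
    moreover have "qhalf (- int (inv_count n (adj s \<circ> w))) = qhalf (- int (inv_count n w)) * qhalf 1"
      using inv_count_down[OF w s True] by (simp flip: qhalf_add)
    moreover have "\<not> descent s (adj s \<circ> w)" using True by (simp add: descent_adj[OF w])
    ultimately show ?thesis
      using True unfolding hecke_coeff_def by (simp add: algebra_simps)
  next
    case False
    then have "hecke_coeff (Suc k) w = qhalf (- int (inv_count n w)) *
        (path_coeff k w + qhalf 1 * path_coeff k (adj s \<circ> w))"
      using rec not_descent[OF w False] by (simp add: hecke_coeff_def)
    moreover have "qhalf (- int (inv_count n (adj s \<circ> w))) * q_var = qhalf (- int (inv_count n w)) * qhalf 1"
      using inv_count_up[OF w s False] by (simp flip: qhalf_add)
    moreover have "descent s (adj s \<circ> w)" using False by (simp add: descent_adj[OF w])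
    ultimately show ?thesis
      using False unfolding hecke_coeff_def by (simp add: algebra_simps)
  qed
qed

lemma hecke_product_expansion:
  "k \<le> length ss \<Longrightarrow> H.rel_cong (prod_list (map (\<lambda>i. 1 + fvar i) (take k ss)))
    (\<Sum>w\<in>perms. fscalar (hecke_coeff k w) * H.T_word w)"
proof (induction k)
  case 0
  have "(\<Sum>w\<in>perms. fscalar (hecke_coeff 0 w) * H.T_word w)
      = (\<Sum>w\<in>perms. if w = id then 1 else 0)"
  proof (rule sum.cong)
    fix w assume "w \<in> perms"
    then have "hecke_coeff 0 w = (if w = id then 1 else 0)"
      using path_coeff_0[of w] by (auto simp: hecke_coeff_def qhalf_def)
    then show "fscalar (hecke_coeff 0 w) * H.T_word w = (if w = id then 1 else 0)"
      by (simp add: H.T_word_id fscalar_one fscalar_zero)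
  qed simp
  also have "\<dots> = 1"
    by (simp add: finite_permutations permutes_id)
  finally show ?case by simp
next
  case (Suc k)
  then have k: "k < length ss" by simp
  define s where "s = crossing ss (Suc k)"
  define e where "e = (\<lambda>w. if descent s w then q_var else 1)"
  let ?T = H.T_word and ?c = "hecke_coeff k"
  have s: "s \<in> {1..<n}" using crossing_bounds[of "Suc k"] k by (simp add: s_def)
  have take: "take (Suc k) ss = take k ss @ [s]"
    using k by (simp add: s_def crossing_def take_Suc_conv_app_nth)
  have "1 + fvar s \<in> carrier H.F"
    by (intro free_algebra_closed(1) free_algebra_one_closed H.gen_closed s)
  then have c1: "H.rel_cong (prod_list (map (\<lambda>i. 1 + fvar i) (take k ss)) * (1 + fvar s))
      ((\<Sum>w\<in>perms. fscalar (?c w) * ?T w) * (1 + fvar s))"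
    using H.cong_mult_right[OF Suc.IH] k by simp
  have c2: "H.rel_cong ((\<Sum>w\<in>perms. fscalar (?c w) * ?T w) * (1 + fvar s))
      (\<Sum>w\<in>perms. fscalar (?c w) * (fscalar (e w) * (?T w + ?T (adj s \<circ> w))))"
    unfolding sum_distrib_right mult.assoc e_def
    by (intro H.cong_sum H.cong_mult_left H.T_word_mult_one_plus s fscalar_closed) simp
  have eq1: "(\<Sum>w\<in>perms. fscalar (?c w) * (fscalar (e w) * (?T w + ?T (adj s \<circ> w))))
      = (\<Sum>w\<in>perms. fscalar (?c w * e w) * ?T w) + (\<Sum>w\<in>perms. fscalar (?c w * e w) * ?T (adj s \<circ> w))"
    by (simp add: fscalar_mult mult.assoc distrib_left sum.distrib)
  \<comment> \<open>\<open>T_w\<close> receives contributions from \<open>w\<close> and from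
    \<open>adj s \<circ> w\<close>; the involution gathers the second kind at the same
    index.\<close>
  have eq2: "(\<Sum>w\<in>perms. fscalar (?c w * e w) * ?T (adj s \<circ> w))
      = (\<Sum>w\<in>perms. fscalar (?c (adj s \<circ> w) * e (adj s \<circ> w)) * ?T w)"
    by (rule sum.reindex_bij_witness[of _ "\<lambda>w. adj s \<circ> w" "\<lambda>w. adj s \<circ> w"])
      (use s in \<open>auto simp only: adj_comp_adj adj_comp_permutes mem_Collect_eq\<close>)
  have eq3: "(\<Sum>w\<in>perms. fscalar (?c w * e w) * ?T w)
        + (\<Sum>w\<in>perms. fscalar (?c (adj s \<circ> w) * e (adj s \<circ> w)) * ?T w)
      = (\<Sum>w\<in>perms. fscalar (hecke_coeff (Suc k) w) * ?T w)"
    unfolding sum.distrib[symmetric] e_def s_def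
    by (rule sum.cong) (simp_all only: hecke_coeff_Suc[OF k] fscalar_add distrib_right mem_Collect_eq)
  show ?case
    using H.cong_trans[OF c1 c2[unfolded eq1 eq2 eq3]] by (simp add: take)
qed

lemma theta_product:
  assumes "linear_on (hecke n) (carrier (hecke n)) \<theta>"
  shows "\<theta> (list_prod (hecke n) (map (\<lambda>i. \<one>\<^bsub>hecke n\<^esub> \<oplus>\<^bsub>hecke n\<^esub> hecke_gen n i) ss))
    = (\<Sum>w\<in>perms. hecke_coeff (length ss) w * \<theta> (hecke_T n w))"
proof -
  have closed: "1 + fvar i \<in> carrier H.F" if "i \<in> set ss" for i
    using expr that by (intro free_closed H.gen_closed) (auto simp: is_expression_def)
  have "map (\<lambda>i. \<one>\<^bsub>hecke n\<^esub> \<oplus>\<^bsub>hecke n\<^esub> hecke_gen n i) ss = map (\<lambda>i. H.cls (1 + fvar i)) ss"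
    using expr by (auto simp: H.hecke_eq H.hecke_gen_cls H.cls_one is_expression_def
        intro!: H.cls_add free_closed H.gen_closed)
  then have "list_prod (hecke n) (map (\<lambda>i. \<one>\<^bsub>hecke n\<^esub> \<oplus>\<^bsub>hecke n\<^esub> hecke_gen n i) ss)
      = H.cls (prod_list (map (\<lambda>i. 1 + fvar i) ss))"
    using H.cls_prod_list[of ss "\<lambda>i. 1 + fvar i", OF closed] by (simp only: H.hecke_eq)
  also have "\<dots> = H.cls (\<Sum>w\<in>perms. fscalar (hecke_coeff (length ss) w) * H.T_word w)"
    using hecke_product_expansion[of "length ss"] closed
    by (subst H.cls_eq_iff) (auto intro!: free_algebra_prod_list_closed free_algebra_sum_closed
        free_algebra_closed(2) fscalar_closed H.T_word_closed)
  also have "\<theta> \<dots> = (\<Sum>w\<in>perms. hecke_coeff (length ss) w * \<theta> (H.cls (H.T_word w)))"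
    by (rule H.linear_on_cls_sum[OF assms]) (simp_all add: finite_permutations H.T_word_closed)
  also have "\<dots> = (\<Sum>w\<in>perms. hecke_coeff (length ss) w * \<theta> (hecke_T n w))"
    by (rule sum.cong) (simp_all add: H.hecke_T_cls)
  finally show ?thesis .
qed

lemma sigma_Imm:
  "sigma n ss (Imm n \<theta>) = (\<Sum>w\<in>perms. hecke_coeff (length ss) w * \<theta> (hecke_T n w))"
proof -
  have "sigma n ss (Imm n \<theta>) =
      (\<Sum>w\<in>perms. \<theta> (hecke_T n w) * qhalf (- int (perm_length n w)) * torus_coeff w)"
    unfolding Imm_def by (rule conjunct2[OF sigma_sum]) (simp_all add: finite_permutations)
  also have "\<dots> = (\<Sum>w\<in>perms. hecke_coeff (length ss) w * \<theta> (hecke_T n w))"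
    by (rule sum.cong)
      (simp_all only: hecke_coeff_def path_coeff_length perm_length_eq_inv_count mem_Collect_eq mult_ac)
  finally show ?thesis .
qed

end

theorem theorem3p7:
  fixes n :: nat and ss :: "nat list" and \<theta> :: "nat freealg set \<Rightarrow> laurent"
  assumes "linear_on (hecke n) (carrier (hecke n)) \<theta>"
    and "is_expression n ss"
  shows "\<theta> (list_prod (hecke n)
              (map (\<lambda>i. \<one>\<^bsub>hecke n\<^esub> \<oplus>\<^bsub>hecke n\<^esub> hecke_gen n i) ss))
         = sigma n ss (Imm n \<theta>)"
proof -
  interpret hecke_wiring n ss
    by standard (rule assms(2))
  show ?thesis
    using theta_product[OF assms(1)] sigma_Imm by simp
qed

end
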